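(* Let $k \ge 2$. For every $i$ with $1 \le i \le k-1$, the maximal subgroups of the $\mathcal{D}$-class $D_i$ of the Thompson-Higman monoid $M_{k,1}$ are isomorphic to the Thompson-Higman group $G_{k,i}$.
   Context: Let $A=\{a_1,\dots,a_k\}$ with $k\ge 2$ and $B=\{b_1,\dots,b_i\}$ with $i\ge 1$ be finite alphabets. $A^*$ is the set of all finite words over $A$ (including the empty word), and $BA^*$ is the set of words $b_jx$ with $b_j\in B$, $x\in A^*$. A right ideal of $BA^*$ is a subset $R\subseteq BA^*$ with $RA^*=R$ (the empty set is allowed). A prefix code in $BA^*$ is a set of words none of which is a proper prefix of another; every finitely generated right ideal equals $PA^*$ for a unique finite prefix code $P$. Two sets intersect iff their intersection is non-empty. A right ideal is essential iff it intersects every non-empty right ideal of $BA^*$. Two right ideals are essentially equal iff every right ideal of $BA^*$ that intersects one also intersects the other. A right ideal homomorphism over $BA^*$ is a total surjective function $\varphi:R_1\to R_2$ between finitely generated right ideals of $BA^*$ with $\varphi(rx)=\varphi(r)x$ for all $r\in R_1$, $x\in A^*$; write $\mathsf{Dom}(\varphi)=R_1$, $\mathsf{Im}(\varphi)=R_2$, and let $\mathsf{imC}(\varphi)$ be the finite prefix code with $\mathsf{Im}(\varphi)=\mathsf{imC}(\varphi)A^*$. Two right ideal homomorphisms are essentially equal iff their domains are essentially equal and they agree on the intersection of their domains. Every right ideal homomorphism $\varphi$ has a unique maximal essentially equal extension to a right ideal homomorphism, denoted $\max(\varphi)$. A right ideal isomorphism is a bijective right ideal homomorphism whose domain and image are both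 essential. $M_{k,i}$ is the monoid of all maximally extended right ideal homomorphisms over $BA^*$, with product $\psi\varphi=\max(\psi\circ\varphi)$ ($\circ$ is composition of partial functions, $\varphi$ applied first). $G_{k,i}$ is the group of all maximally extended right ideal isomorphisms, with the same multiplication. For $i=1$ one identifies $b_1A^*$ with $A^*$. The zero $\mathbf 0$ of $M_{k,1}$ is the empty map. Green's relations in a monoid $M$: $u\le_{\mathcal L}v$ iff $u=xv$ for some $x\in M$; $u\le_{\mathcal R}v$ iff $u=vx$ for some $x\in M$; $\equiv_{\mathcal L},\equiv_{\mathcal R}$ are the associated equivalences; $u\equiv_{\mathcal D}v$ iff there is $s\in M$ with $u\equiv_{\mathcal R}s\equiv_{\mathcal L}v$. $M_{k,1}$ has exactly $k-1$ non-zero $\mathcal D$-classes, namely $D_i=\{\varphi\in M_{k,1}:\varphi\neq\mathbf 0,\ |\mathsf{imC}(\varphi)|\equiv i \bmod (k-1)\}$ for $1\le i\le k-1$. A maximal subgroup of a semigroup is a subgroup (a subsemigroup that is a group, whose identity may be any idempotent) not strictly contained in another subgroup. *)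

theory Defs
  imports "HOL-Algebra.Group" "HOL-Library.Sublist" "HOL-Number_Theory.Cong"
begin

section \<open>Right ideals of \<open>BA\<^sup>*\<close>\<close>

text \<open>
  The alphabets \<open>A\<close> and \<open>B\<close> are sets of letters of one type. A word \<open>b x\<close> of \<open>BA\<^sup>*\<close> is the list
  \<open>b # x\<close>. Since the first position is reserved for \<open>B\<close>, the two alphabets need not be disjoint.
  The case of a one-letter \<open>B = {b}\<close> is the copy \<open>bA\<^sup>*\<close> of \<open>A\<^sup>*\<close>.
\<close>

definition words :: "'a set \<Rightarrow> 'a set \<Rightarrow> 'a list set" where
  "words A B = {b # x | b x. b \<in> B \<and> x \<in> lists A}"

definition gen :: "'a set \<Rightarrow> 'a list set \<Rightarrow> 'a list set" where
  "gen A R = {r @ x | r x. r \<in> R \<and> x \<in> lists A}"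

definition right_ideal :: "'a set \<Rightarrow> 'a set \<Rightarrow> 'a list set \<Rightarrow> bool" where
  "right_ideal A B R \<longleftrightarrow> R \<subseteq> words A B \<and> gen A R = R"

definition fg_right_ideal :: "'a set \<Rightarrow> 'a set \<Rightarrow> 'a list set \<Rightarrow> bool" where
  "fg_right_ideal A B R \<longleftrightarrow> right_ideal A B R \<and> (\<exists>F. finite F \<and> R = gen A F)"

definition prefix_code :: "'a set \<Rightarrow> 'a set \<Rightarrow> 'a list set \<Rightarrow> bool" where
  "prefix_code A B P \<longleftrightarrow> P \<subseteq> words A B \<and> (\<forall>p\<in>P. \<forall>q\<in>P. \<not> strict_prefix p q)"

definition essential :: "'a set \<Rightarrow> 'a set \<Rightarrow> 'a list set \<Rightarrow> bool" where
  "essential A B R \<longleftrightarrow>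
     right_ideal A B R \<and> (\<forall>S. right_ideal A B S \<and> S \<noteq> {} \<longrightarrow> R \<inter> S \<noteq> {})"

definition ess_equal :: "'a set \<Rightarrow> 'a set \<Rightarrow> 'a list set \<Rightarrow> 'a list set \<Rightarrow> bool" where
  "ess_equal A B R\<^sub>1 R\<^sub>2 \<longleftrightarrow>
     (\<forall>S. right_ideal A B S \<longrightarrow> (S \<inter> R\<^sub>1 \<noteq> {} \<longleftrightarrow> S \<inter> R\<^sub>2 \<noteq> {}))"


section \<open>Right ideal homomorphisms\<close>

text \<open>
  A homomorphism is a partial function on words. Its domain is \<open>dom f\<close> and its image is \<open>ran f\<close>,
  so totality and surjectivity hold by construction.
\<close>

type_synonym 'a pfun = "'a list \<Rightarrow> 'a list option"

definition ri_hom :: "'a set \<Rightarrow> 'a set \<Rightarrow> 'a pfun \<Rightarrow> bool" where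
  "ri_hom A B f \<longleftrightarrow>
     fg_right_ideal A B (dom f) \<and> fg_right_ideal A B (ran f) \<and>
     (\<forall>r\<in>dom f. \<forall>x\<in>lists A. f (r @ x) = Some (the (f r) @ x))"

definition ri_iso :: "'a set \<Rightarrow> 'a set \<Rightarrow> 'a pfun \<Rightarrow> bool" where
  "ri_iso A B f \<longleftrightarrow>
     ri_hom A B f \<and> inj_on f (dom f) \<and> essential A B (dom f) \<and> essential A B (ran f)"

definition imC :: "'a set \<Rightarrow> 'a set \<Rightarrow> 'a pfun \<Rightarrow> 'a list set" where
  "imC A B f = (THE P. finite P \<and> prefix_code A B P \<and> ran f = gen A P)"

definition hom_ess_equal :: "'a set \<Rightarrow> 'a set \<Rightarrow> 'a pfun \<Rightarrow> 'a pfun \<Rightarrow> bool" where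
  "hom_ess_equal A B f g \<longleftrightarrow>
     ess_equal A B (dom f) (dom g) \<and> (\<forall>x\<in>dom f \<inter> dom g. f x = g x)"

definition ess_extension :: "'a set \<Rightarrow> 'a set \<Rightarrow> 'a pfun \<Rightarrow> 'a pfun \<Rightarrow> bool" where
  "ess_extension A B f g \<longleftrightarrow> ri_hom A B g \<and> hom_ess_equal A B f g \<and> f \<subseteq>\<^sub>m g"

definition max_ext :: "'a set \<Rightarrow> 'a set \<Rightarrow> 'a pfun \<Rightarrow> 'a pfun" where
  "max_ext A B f =
     (THE g. ess_extension A B f g \<and> (\<forall>h. ess_extension A B f h \<and> g \<subseteq>\<^sub>m h \<longrightarrow> h = g))"


section \<open>The Thompson-Higman monoids and groups\<close>

text \<open>
  With \<open>k = card A\<close> and \<open>i = card B\<close>, these are \<open>M\<^sub>k\<^sub>,\<^sub>i\<close> and \<open>G\<^sub>k\<^sub>,\<^sub>i\<close>. In \<open>g \<circ>\<^sub>m f\<close> the map \<open>f\<close> is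
  applied first.
\<close>

definition TH_monoid :: "'a set \<Rightarrow> 'a set \<Rightarrow> 'a pfun monoid" where
  "TH_monoid A B =
     \<lparr>carrier = {f. ri_hom A B f \<and> max_ext A B f = f},
      monoid.mult = (\<lambda>g f. max_ext A B (g \<circ>\<^sub>m f)),
      one = (\<lambda>w. if w \<in> words A B then Some w else None)\<rparr>"

definition TH_group :: "'a set \<Rightarrow> 'a set \<Rightarrow> 'a pfun monoid" where
  "TH_group A B = (TH_monoid A B)\<lparr>carrier := {f. ri_iso A B f \<and> max_ext A B f = f}\<rparr>"


section \<open>Green's relations and maximal subgroups\<close>

definition le_L :: "('m, 'c) monoid_scheme \<Rightarrow> 'm \<Rightarrow> 'm \<Rightarrow> bool" where
  "le_L M u v \<longleftrightarrow> (\<exists>x\<in>carrier M. u = x \<otimes>\<^bsub>M\<^esub> v)"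

definition le_R :: "('m, 'c) monoid_scheme \<Rightarrow> 'm \<Rightarrow> 'm \<Rightarrow> bool" where
  "le_R M u v \<longleftrightarrow> (\<exists>x\<in>carrier M. u = v \<otimes>\<^bsub>M\<^esub> x)"

definition eq_L :: "('m, 'c) monoid_scheme \<Rightarrow> 'm \<Rightarrow> 'm \<Rightarrow> bool" where
  "eq_L M u v \<longleftrightarrow> le_L M u v \<and> le_L M v u"

definition eq_R :: "('m, 'c) monoid_scheme \<Rightarrow> 'm \<Rightarrow> 'm \<Rightarrow> bool" where
  "eq_R M u v \<longleftrightarrow> le_R M u v \<and> le_R M v u"

definition eq_D :: "('m, 'c) monoid_scheme \<Rightarrow> 'm \<Rightarrow> 'm \<Rightarrow> bool" where
  "eq_D M u v \<longleftrightarrow> (\<exists>s\<in>carrier M. eq_R M u s \<and> eq_L M s v)"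

definition D_classes :: "('m, 'c) monoid_scheme \<Rightarrow> 'm set set" where
  "D_classes M = {{v \<in> carrier M. eq_D M u v} | u. u \<in> carrier M}"

text \<open>
  \<open>HOL-Algebra\<close>'s \<^const>\<open>subgroup\<close> forces the identity of the ambient structure on the subgroup;
  here the identity \<open>e\<close> of a subgroup of a monoid may be any idempotent.
\<close>

definition subgroup_at :: "('m, 'c) monoid_scheme \<Rightarrow> 'm set \<Rightarrow> 'm \<Rightarrow> bool" where
  "subgroup_at M H e \<longleftrightarrow> H \<subseteq> carrier M \<and> group (M\<lparr>carrier := H, one := e\<rparr>)"

definition maximal_subgroup_at :: "('m, 'c) monoid_scheme \<Rightarrow> 'm set \<Rightarrow> 'm \<Rightarrow> bool" where
  "maximal_subgroup_at M H e \<longleftrightarrow>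
     subgroup_at M H e \<and> (\<forall>H' e'. subgroup_at M H' e' \<longrightarrow> \<not> H \<subset> H')"


section \<open>The non-zero \<open>\<D>\<close>-classes of \<open>M\<^sub>k\<^sub>,\<^sub>1\<close>\<close>

text \<open>The zero of \<open>M\<^sub>k\<^sub>,\<^sub>1\<close> is \<^term>\<open>Map.empty\<close>.\<close>

definition D_index_class :: "'a set \<Rightarrow> 'a \<Rightarrow> nat \<Rightarrow> 'a pfun set" where
  "D_index_class A b i =
     {f \<in> carrier (TH_monoid A {b}). f \<noteq> Map.empty \<and>
        [card (imC A {b} f) = i] (mod (card A - 1))}"

end

theory Submission
  imports Defs
begin

text \<open>
  Right ideal homomorphisms \<open>BA\<^sup>* \<rightharpoonup> CA\<^sup>*\<close>, for varying letter sets \<open>B\<close> and \<open>C\<close>, form a category modulo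
  essential equality. A complete prefix code of \<open>BA\<^sup>*\<close> has \<open>|B|\<close> elements modulo \<open>k - 1\<close>, because each
  refinement of a word \<open>p\<close> to \<open>pA\<close> adds \<open>k - 1\<close> of them. Hence a nonzero \<open>u\<close> with \<open>|imC u| \<equiv> |B|\<close>
  factors as \<open>u = \<alpha>\<beta>\<close> through \<open>BA\<^sup>*\<close> with \<open>\<alpha>\<close> left invertible and \<open>\<beta>\<close> right invertible. If two elements
  are \<open>\<D>\<close>-related, the objects through which they factor in this way are isomorphic, so \<open>|B|\<close> is
  an invariant modulo \<open>k - 1\<close>. For an idempotent \<open>e = \<alpha>\<beta>\<close> one gets \<open>\<beta>\<alpha> = 1\<close>, and \<open>g \<mapsto> \<alpha>g\<beta>\<close> maps the units
  of the endomorphisms of \<open>BA\<^sup>*\<close> isomorphically onto the maximal subgroup at \<open>e\<close>.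
\<close>

section \<open>Homomorphisms up to essential equality\<close>

text \<open>These default rules unfold \<open>x \<in> lists A\<close> into a statement about \<open>set x\<close>,
  where the closure lemmas for \<open>gen A\<close> no longer apply.\<close>

declare in_listsD [rule del] in_listsI [rule del]

text \<open>The product of the monoid takes a maximal extension after every composition, and
  \<open>max_map\<close> extends only maps of one \<open>words A B\<close> into itself. The
  factorisations pass through other letter sets, so all calculations use plain
  \<open>\<circ>\<^sub>m\<close> modulo the congruence \<open>sim\<close>; \<open>max_ext\<close>
  merely selects one representative of each class of endomorphisms. Counting needs actual codes,
  whereas an isomorphism modulo \<open>sim\<close> may be undefined on short words. On all
  sufficiently long words the composite of the two maps is literally the identity, so the words of
  one large length are carried injectively onto a complete code of the other side. The zero obeys
  the same pattern: it factors through the empty letter set, which is not isomorphic to a nonempty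
  one. Maximality of a subgroup H at e enters in one place. Every subgroup at e lies in the set of
  all \<alpha>g\<beta> with g a unit, because h = ehe; this set is itself a group, so a maximal H is
  all of it.\<close>

definition hom_between :: "'a set \<Rightarrow> 'a set \<Rightarrow> 'a set \<Rightarrow> 'a pfun \<Rightarrow> bool" where
  "hom_between A B C f \<longleftrightarrow>
     dom f \<subseteq> words A B \<and> ran f \<subseteq> words A C \<and> (\<exists>F. finite F \<and> dom f = gen A F) \<and>
     (\<forall>w x u. f w = Some u \<longrightarrow> x \<in> lists A \<longrightarrow> f (w @ x) = Some (u @ x))"

text \<open>Agreement on a dense set of words, stable under right extension. On homomorphisms this is
  essential equality, but it is an equivalence for arbitrary partial functions.\<close>

definition sim :: "'a set \<Rightarrow> 'a set \<Rightarrow> 'a pfun \<Rightarrow> 'a pfun \<Rightarrow> bool" where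
  "sim A B f g \<longleftrightarrow>
     (\<forall>w\<in>words A B. \<exists>x\<in>lists A. \<forall>y\<in>lists A. f (w @ x @ y) = g (w @ x @ y))"

definition id_on :: "'a set \<Rightarrow> 'a set \<Rightarrow> 'a pfun" where
  "id_on A B = (\<lambda>w. if w \<in> words A B then Some w else None)"

text \<open>The maximal extension: \<open>w\<close> is sent to \<open>u\<close> iff \<open>f\<close> is given below \<open>w\<close>, up to \<open>sim\<close>, by
  \<open>w x \<mapsto> u x\<close>.\<close>

definition max_map :: "'a set \<Rightarrow> 'a set \<Rightarrow> 'a pfun \<Rightarrow> 'a pfun" where
  "max_map A B f = (\<lambda>w. if w \<in> words A B \<and> (\<exists>u\<in>words A B. \<forall>y\<in>lists A. \<exists>z\<in>lists A. \<forall>z'\<in>lists A.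
       f (w @ y @ z @ z') = Some (u @ y @ z @ z'))
     then Some (THE u. u \<in> words A B \<and> (\<forall>y\<in>lists A. \<exists>z\<in>lists A. \<forall>z'\<in>lists A.
       f (w @ y @ z @ z') = Some (u @ y @ z @ z'))) else None)"

section \<open>Words and the right ideals they generate\<close>

lemma words_append: "w \<in> words A B \<Longrightarrow> x \<in> lists A \<Longrightarrow> w @ x \<in> words A B"
  unfolding words_def by fastforce

lemma words_prefix: "w @ x \<in> words A B \<Longrightarrow> w \<noteq> [] \<Longrightarrow> w \<in> words A B \<and> x \<in> lists A"
  unfolding words_def by (cases w) auto

lemma genI: "r \<in> R \<Longrightarrow> x \<in> lists A \<Longrightarrow> r @ x \<in> gen A R"
  unfolding gen_def by blast

lemma genE:
  assumes "w \<in> gen A R" obtains r x where "w = r @ x" "r \<in> R" "x \<in> lists A"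
  using assms unfolding gen_def by blast

lemma gen_base: "r \<in> R \<Longrightarrow> r \<in> gen A R"
  using genI[of r R "[]" A] by simp

lemma gen_append: "w \<in> gen A R \<Longrightarrow> x \<in> lists A \<Longrightarrow> w @ x \<in> gen A R"
  by (elim genE) (simp add: genI)

lemma gen_gen: "gen A (gen A R) = gen A R"
  by (auto elim!: genE intro: gen_append gen_base)

lemma gen_eq_iff: "gen A R = R \<longleftrightarrow> (\<forall>r\<in>R. \<forall>x\<in>lists A. r @ x \<in> R)"
proof
  show "\<forall>r\<in>R. \<forall>x\<in>lists A. r @ x \<in> R" if "gen A R = R"
    using genI[of _ R _ A] that by simp
qed (auto elim!: genE intro: gen_base)

lemma gen_subset_words: "F \<subseteq> words A B \<Longrightarrow> gen A F \<subseteq> words A B"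
  by (auto elim!: genE intro: words_append)

lemma right_ideal_gen: "F \<subseteq> words A B \<Longrightarrow> right_ideal A B (gen A F)"
  by (simp add: right_ideal_def gen_gen gen_subset_words)

lemma right_ideal_append: "right_ideal A B R \<Longrightarrow> w \<in> R \<Longrightarrow> x \<in> lists A \<Longrightarrow> w @ x \<in> R"
  unfolding right_ideal_def using gen_append by metis

text \<open>Every nonempty right ideal contains some \<open>gen A {w}\<close>, so principal ideals
  suffice as tests and essentiality turns into density.\<close>

lemma essential_iff:
  assumes "right_ideal A B R"
  shows "essential A B R \<longleftrightarrow> (\<forall>w\<in>words A B. \<exists>x\<in>lists A. w @ x \<in> R)"
proof
  assume e: "essential A B R"
  show "\<forall>w\<in>words A B. \<exists>x\<in>lists A. w @ x \<in> R"
  proof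
    fix w assume "w \<in> words A B"
    then have "right_ideal A B (gen A {w})" "gen A {w} \<noteq> {}"
      using right_ideal_gen[of "{w}" A B] gen_base[of w "{w}" A] by auto
    then have "R \<inter> gen A {w} \<noteq> {}" using e unfolding essential_def by simp
    then show "\<exists>x\<in>lists A. w @ x \<in> R" by (auto elim!: genE)
  qed
next
  assume d: "\<forall>w\<in>words A B. \<exists>x\<in>lists A. w @ x \<in> R"
  have "R \<inter> S \<noteq> {}" if S: "right_ideal A B S" "S \<noteq> {}" for S
  proof -
    obtain w where w: "w \<in> S" using S by auto
    then have "w \<in> words A B" using S unfolding right_ideal_def by auto
    then obtain x where "x \<in> lists A" "w @ x \<in> R" using d by metis
    then show ?thesis using right_ideal_append[OF S(1) w] by auto
  qed
  then show "essential A B R" using assms unfolding essential_def by simp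
qed

text \<open>Again principal ideals suffice: an ideal S meets T exactly when some word of S can be
  prolonged into T, since the prolonged word stays in S.\<close>

lemma ess_equal_iff:
  assumes "right_ideal A B R" "right_ideal A B R'"
  shows "ess_equal A B R R' \<longleftrightarrow>
    (\<forall>w\<in>words A B. (\<exists>x\<in>lists A. w @ x \<in> R) \<longleftrightarrow> (\<exists>x\<in>lists A. w @ x \<in> R'))"
proof
  assume e: "ess_equal A B R R'"
  show "\<forall>w\<in>words A B. (\<exists>x\<in>lists A. w @ x \<in> R) \<longleftrightarrow> (\<exists>x\<in>lists A. w @ x \<in> R')"
  proof
    fix w assume "w \<in> words A B"
    then have r: "right_ideal A B (gen A {w})"
      using right_ideal_gen[of "{w}" A B] by auto
    have *: "(\<exists>x\<in>lists A. w @ x \<in> T) \<longleftrightarrow> gen A {w} \<inter> T \<noteq> {}" for T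
      using genI[of w "{w}" _ A] by (auto elim!: genE)
    show "(\<exists>x\<in>lists A. w @ x \<in> R) \<longleftrightarrow> (\<exists>x\<in>lists A. w @ x \<in> R')"
      using e r unfolding ess_equal_def * by simp
  qed
next
  assume d: "\<forall>w\<in>words A B. (\<exists>x\<in>lists A. w @ x \<in> R) \<longleftrightarrow> (\<exists>x\<in>lists A. w @ x \<in> R')"
  have "S \<inter> T \<noteq> {} \<longleftrightarrow> (\<exists>w\<in>S. \<exists>x\<in>lists A. w @ x \<in> T)" if "right_ideal A B S" for S T
  proof -
    show ?thesis
    proof
      assume "S \<inter> T \<noteq> {}"
      then obtain w where "w \<in> S" "w @ [] \<in> T" by auto
      then show "\<exists>w\<in>S. \<exists>x\<in>lists A. w @ x \<in> T" using lists.Nil by blast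
    next
      assume "\<exists>w\<in>S. \<exists>x\<in>lists A. w @ x \<in> T"
      then obtain w x where "w \<in> S" "x \<in> lists A" "w @ x \<in> T" by blast
      then show "S \<inter> T \<noteq> {}" using right_ideal_append[OF that, of w x] by auto
    qed
  qed
  moreover have "(\<exists>w\<in>S. \<exists>x\<in>lists A. w @ x \<in> R) \<longleftrightarrow> (\<exists>w\<in>S. \<exists>x\<in>lists A. w @ x \<in> R')"
    if "right_ideal A B S" for S
  proof (rule bex_cong[OF refl])
    fix w assume "w \<in> S"
    then have "w \<in> words A B" using that unfolding right_ideal_def by blast
    then show "(\<exists>x\<in>lists A. w @ x \<in> R) \<longleftrightarrow> (\<exists>x\<in>lists A. w @ x \<in> R')" by (rule d[rule_format])
  qed
  ultimately show "ess_equal A B R R'" unfolding ess_equal_def by simp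
qed

section \<open>Homomorphisms between different letter sets\<close>

lemma hom_betweenD:
  assumes "hom_between A B C f"
  shows hom_dom: "f w = Some u \<Longrightarrow> w \<in> words A B"
    and hom_ran: "f w = Some u \<Longrightarrow> u \<in> words A C"
    and hom_append: "f w = Some u \<Longrightarrow> x \<in> lists A \<Longrightarrow> f (w @ x) = Some (u @ x)"
proof -
  have *: "dom f \<subseteq> words A B" "ran f \<subseteq> words A C"
      "\<forall>w x u. f w = Some u \<longrightarrow> x \<in> lists A \<longrightarrow> f (w @ x) = Some (u @ x)"
    using assms unfolding hom_between_def by blast+
  show "f w = Some u \<Longrightarrow> w \<in> words A B" using *(1) domI by fast
  show "f w = Some u \<Longrightarrow> u \<in> words A C" using *(2) ranI by fast
  show "f w = Some u \<Longrightarrow> x \<in> lists A \<Longrightarrow> f (w @ x) = Some (u @ x)" using *(3) by simp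
qed

lemma hom_fg:
  assumes "hom_between A B C f" obtains F where "finite F" "dom f = gen A F" "F \<subseteq> dom f"
proof -
  obtain F where F: "finite F" "dom f = gen A F" using assms unfolding hom_between_def by blast
  show thesis by (rule that[of F]) (use F gen_base in auto)
qed

lemma hom_right_ideal:
  assumes "hom_between A B C f"
  shows "right_ideal A B (dom f)" "right_ideal A C (ran f)"
  unfolding right_ideal_def gen_eq_iff
  using assms by (auto simp: ran_def dest: hom_betweenD)

text \<open>Compatibility with right multiplication carries a finite generating set of the domain to
  one of the image.\<close>

lemma hom_ran_fg:
  assumes f: "hom_between A B C f" obtains F where "finite F" "ran f = gen A F"
proof -
  obtain F where F: "finite F" "dom f = gen A F" "F \<subseteq> dom f" using hom_fg[OF f] .
  have "ran f = gen A ((the \<circ> f) ` F)"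
  proof
    show "ran f \<subseteq> gen A ((the \<circ> f) ` F)"
    proof
      fix u assume "u \<in> ran f"
      then obtain w where w: "f w = Some u" by (auto simp: ran_def)
      then have "w \<in> gen A F" using F by auto
      then obtain p x where px: "w = p @ x" "p \<in> F" "x \<in> lists A" by (elim genE)
      obtain v where v: "f p = Some v" using px F(3) by auto
      have "u = v @ x" using hom_append[OF f v] px w by auto
      moreover have "v \<in> (the \<circ> f) ` F" using px v by (auto intro!: image_eqI[of _ _ p])
      ultimately show "u \<in> gen A ((the \<circ> f) ` F)" using px by (simp add: genI)
    qed
    show "gen A ((the \<circ> f) ` F) \<subseteq> ran f"
    proof
      fix u assume "u \<in> gen A ((the \<circ> f) ` F)"
      then obtain p x where px: "u = the (f p) @ x" "p \<in> F" "x \<in> lists A" by (auto elim!: genE)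
      obtain v where v: "f p = Some v" using px F(3) by auto
      then show "u \<in> ran f" using hom_append[OF f v, of x] px by (auto intro: ranI)
    qed
  qed
  then show thesis using that F by blast
qed

text \<open>\<open>hom_ran_fg\<close> supplies the finite generation of the image, and
  \<open>the (f r)\<close> is traded for an explicit value. The elements of the monoid become the
  endomorphisms of the category.\<close>

lemma ri_hom_iff: "ri_hom A B f \<longleftrightarrow> hom_between A B B f"
proof
  assume "ri_hom A B f"
  then have d: "right_ideal A B (dom f)" "\<exists>F. finite F \<and> dom f = gen A F" "right_ideal A B (ran f)"
    and a: "\<And>w x. w \<in> dom f \<Longrightarrow> x \<in> lists A \<Longrightarrow> f (w @ x) = Some (the (f w) @ x)"
    unfolding ri_hom_def fg_right_ideal_def by simp_all
  have "f (w @ x) = Some (u @ x)" if "f w = Some u" "x \<in> lists A" for w x u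
    using a[of w x] that by (simp add: domI)
  then show "hom_between A B B f"
    using d unfolding hom_between_def right_ideal_def by simp
next
  assume f: "hom_between A B B f"
  have "\<exists>F. finite F \<and> dom f = gen A F" "\<exists>F. finite F \<and> ran f = gen A F"
    using hom_fg[OF f] hom_ran_fg[OF f] by metis+
  then have "fg_right_ideal A B (dom f)" "fg_right_ideal A B (ran f)"
    unfolding fg_right_ideal_def using hom_right_ideal[OF f] by simp_all
  then show "ri_hom A B f" unfolding ri_hom_def using hom_append[OF f] by auto
qed

lemma hom_comp:
  assumes f: "hom_between A B C f" and g: "hom_between A C D g"
  shows "hom_between A B D (g \<circ>\<^sub>m f)"
  unfolding hom_between_def
proof (intro conjI allI impI)
  show "dom (g \<circ>\<^sub>m f) \<subseteq> words A B" using hom_dom[OF f] by (auto simp: map_comp_Some_iff)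
  show "ran (g \<circ>\<^sub>m f) \<subseteq> words A D" using hom_ran[OF g] by (auto simp: ran_def map_comp_Some_iff)
  show "(g \<circ>\<^sub>m f) (w @ x) = Some (u @ x)" if "(g \<circ>\<^sub>m f) w = Some u" "x \<in> lists A" for w x u
    using that hom_append[OF f] hom_append[OF g] by (auto simp: map_comp_Some_iff)
  obtain F where F: "finite F" "dom f = gen A F" "F \<subseteq> dom f" using hom_fg[OF f] .
  obtain G where G: "finite G" "dom g = gen A G" "G \<subseteq> dom g" using hom_fg[OF g] .
  \<comment> \<open>For generators p of \<open>dom f\<close> and q of \<open>dom g\<close>, there
    are two ways for f(p) and q to be comparable. If q is a prefix of f(p), then p itself lies in
    the domain of the composite; if f(p) is a prefix of q, the \<open>drop\<close> term is the piece
    still to be appended to p. Whatever incomparable pairs produce is filtered by the intersection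
    with the domain.\<close>
  define E where "E = (F \<union> (\<lambda>(p, q). p @ drop (length (the (f p))) q) ` (F \<times> G)) \<inter> dom (g \<circ>\<^sub>m f)"
  have "dom (g \<circ>\<^sub>m f) \<subseteq> gen A E"
  proof
    fix w assume w: "w \<in> dom (g \<circ>\<^sub>m f)"
    then obtain u t where u: "f w = Some u" "g u = Some t" by (auto simp: map_comp_Some_iff)
    have "w \<in> gen A F" unfolding F(2)[symmetric] using u(1) by (rule domI)
    then obtain p x where px: "w = p @ x" "p \<in> F" "x \<in> lists A" by (rule genE)
    obtain v where v: "f p = Some v" using px F(3) by auto
    have uv: "u = v @ x" using hom_append[OF f v] px u by auto
    have "u \<in> gen A G" unfolding G(2)[symmetric] using u(2) by (rule domI)
    then obtain q y where qy: "u = q @ y" "q \<in> G" "y \<in> lists A" by (rule genE)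
    obtain r where r: "g q = Some r" using qy G(3) by auto
    consider z where "v = q @ z" "y = z @ x" | z where "q = v @ z" "x = z @ y"
      using uv qy by (auto simp: append_eq_append_conv2)
    then show "w \<in> gen A E"
    proof cases
      case 1
      then have "z \<in> lists A" using qy by auto
      then have "g v = Some (r @ z)" using 1 hom_append[OF g r] by simp
      then have "p \<in> E" using px v by (auto simp: E_def map_comp_Some_iff)
      then show ?thesis using px genI by blast
    next
      case 2
      then have z: "z \<in> lists A" using px by auto
      then have "(g \<circ>\<^sub>m f) (p @ z) = Some r" using hom_append[OF f v z] 2 r by (simp add: map_comp_Some_iff)
      moreover have "p @ z = (\<lambda>(p, q). p @ drop (length (the (f p))) q) (p, q)" using v 2 by simp
      ultimately have "p @ z \<in> E" unfolding E_def using px qy by blast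
      then show ?thesis using px 2 qy genI[of "p @ z" E y A] by simp
    qed
  qed
  moreover have "gen A E \<subseteq> dom (g \<circ>\<^sub>m f)"
    using \<open>\<And>x w u. \<lbrakk>(g \<circ>\<^sub>m f) w = Some u; x \<in> lists A\<rbrakk> \<Longrightarrow> (g \<circ>\<^sub>m f) (w @ x) = Some (u @ x)\<close>
    by (auto simp: E_def elim!: genE)
  moreover have "finite E" unfolding E_def using F G by auto
  ultimately show "\<exists>E. finite E \<and> dom (g \<circ>\<^sub>m f) = gen A E" by blast
qed

section \<open>The congruence \<open>sim\<close>\<close>

lemma sim_refl: "sim A B f f"
  unfolding sim_def using lists.Nil by blast

lemma sim_sym: "sim A B f g \<Longrightarrow> sim A B g f"
  unfolding sim_def by (simp add: eq_commute)

lemma simE: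
  assumes "sim A B f g" "w \<in> words A B"
  obtains x where "x \<in> lists A" "\<forall>y\<in>lists A. f (w @ x @ y) = g (w @ x @ y)"
  using bspec[OF assms(1)[unfolded sim_def] assms(2)] that by (elim bexE)

text \<open>Agreement beyond x persists under further extension, so the second witness can be sought
  below w @ x.\<close>

lemma sim_trans [trans]:
  assumes "sim A B f g" "sim A B g h" shows "sim A B f h"
  unfolding sim_def
proof
  fix w assume w: "w \<in> words A B"
  obtain x where x: "x \<in> lists A" "\<forall>y\<in>lists A. f (w @ x @ y) = g (w @ x @ y)"
    using simE[OF assms(1) w] .
  obtain z where z: "z \<in> lists A" "\<forall>y\<in>lists A. g ((w @ x) @ z @ y) = h ((w @ x) @ z @ y)"
    using simE[OF assms(2) words_append[OF w x(1)]] .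
  show "\<exists>x\<in>lists A. \<forall>y\<in>lists A. f (w @ x @ y) = h (w @ x @ y)"
    using x z by (intro bexI[of _ "x @ z"]) auto
qed

lemma sim_comp_left:
  assumes f: "hom_between A B C f" and g: "sim A C g g'"
  shows "sim A B (g \<circ>\<^sub>m f) (g' \<circ>\<^sub>m f)"
  unfolding sim_def
proof
  fix w assume w: "w \<in> words A B"
  show "\<exists>x\<in>lists A. \<forall>y\<in>lists A. (g \<circ>\<^sub>m f) (w @ x @ y) = (g' \<circ>\<^sub>m f) (w @ x @ y)"
  \<comment> \<open>If w can be extended into \<open>dom f\<close>, agreement is sought below the
    image word; otherwise both composites are undefined on everything below w.\<close>
  proof (cases "\<exists>x\<in>lists A. w @ x \<in> dom f")
    case True
    then obtain x u where x: "x \<in> lists A" "f (w @ x) = Some u" by auto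
    obtain z where z: "z \<in> lists A" "\<forall>y\<in>lists A. g (u @ z @ y) = g' (u @ z @ y)"
      using simE[OF g hom_ran[OF f x(2)]] .
    then show ?thesis using x hom_append[OF f x(2)]
      by (intro bexI[of _ "x @ z"]) (auto simp: map_comp_def)
  next
    case False
    then have "f (w @ y) = None" if "y \<in> lists A" for y using that by auto
    then show ?thesis by (auto simp: map_comp_def intro!: bexI[of _ "[]"])
  qed
qed

lemma sim_comp_right:
  assumes "sim A B f f'" shows "sim A B (g \<circ>\<^sub>m f) (g \<circ>\<^sub>m f')"
  unfolding sim_def
proof
  fix w assume "w \<in> words A B"
  then obtain x where "x \<in> lists A" "\<forall>y\<in>lists A. f (w @ x @ y) = f' (w @ x @ y)"
    by (rule simE[OF assms])
  then show "\<exists>x\<in>lists A. \<forall>y\<in>lists A. (g \<circ>\<^sub>m f) (w @ x @ y) = (g \<circ>\<^sub>m f') (w @ x @ y)"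
    by (intro bexI[of _ x]) (auto simp: map_comp_def)
qed

lemma sim_comp:
  assumes "sim A B f f'" "hom_between A B C f" "sim A C g g'"
  shows "sim A B (g \<circ>\<^sub>m f) (g' \<circ>\<^sub>m f')"
  using sim_trans[OF sim_comp_left[OF assms(2,3)] sim_comp_right[OF assms(1)]] .

lemma map_comp_assoc: "(h \<circ>\<^sub>m g) \<circ>\<^sub>m f = h \<circ>\<^sub>m (g \<circ>\<^sub>m f)"
  by (rule ext) (simp add: map_comp_def split: option.split)

lemma id_on_comp: "hom_between A B C f \<Longrightarrow> id_on A C \<circ>\<^sub>m f = f"
  by (rule ext) (auto simp: map_comp_def id_on_def split: option.split dest: hom_ran)

lemma comp_id_on: "hom_between A B C f \<Longrightarrow> f \<circ>\<^sub>m id_on A B = f"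
proof
  fix w assume "hom_between A B C f"
  then show "(f \<circ>\<^sub>m id_on A B) w = f w"
    by (cases "f w") (auto simp: map_comp_def id_on_def dest: hom_dom)
qed

lemma words_eq_gen: "words A B = gen A ((\<lambda>b. [b]) ` B)"
proof (intro equalityI subsetI)
  fix w assume "w \<in> words A B"
  then obtain b x where bx: "w = [b] @ x" "b \<in> B" "x \<in> lists A" unfolding words_def by auto
  then show "w \<in> gen A ((\<lambda>b. [b]) ` B)" using genI[of "[b]" "(\<lambda>b. [b]) ` B" x A] by simp
next
  fix w assume "w \<in> gen A ((\<lambda>b. [b]) ` B)"
  then show "w \<in> words A B" by (auto simp: words_def elim!: genE)
qed

lemma hom_id_on: "finite B \<Longrightarrow> hom_between A B B (id_on A B)"
  unfolding hom_between_def
proof (intro conjI allI impI)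
  have d: "dom (id_on A B) = words A B" by (auto simp: id_on_def split: if_splits)
  then show "dom (id_on A B) \<subseteq> words A B" by simp
  show "finite B \<Longrightarrow> \<exists>F. finite F \<and> dom (id_on A B) = gen A F"
    unfolding d words_eq_gen by blast
qed (auto simp: id_on_def ran_def words_append split: if_splits)

text \<open>Below a given word either both domains are reached, and then a common point is reached
  too, or neither is and both maps are undefined. In the other direction, the values at a common
  point are compared after a common suffix, which cancels.\<close>

lemma hom_ess_equal_iff_sim:
  assumes f: "hom_between A B C f" and g: "hom_between A B C g"
  shows "hom_ess_equal A B f g \<longleftrightarrow> sim A B f g"
proof
  assume e: "hom_ess_equal A B f g"
  then have d: "(\<exists>x\<in>lists A. w @ x \<in> dom f) \<longleftrightarrow> (\<exists>x\<in>lists A. w @ x \<in> dom g)" if "w \<in> words A B" for w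
    using that ess_equal_iff[OF hom_right_ideal(1)[OF f] hom_right_ideal(1)[OF g]]
    unfolding hom_ess_equal_def by blast
  show "sim A B f g" unfolding sim_def
  proof
    fix w assume w: "w \<in> words A B"
    show "\<exists>x\<in>lists A. \<forall>y\<in>lists A. f (w @ x @ y) = g (w @ x @ y)"
    proof (cases "\<exists>x\<in>lists A. w @ x \<in> dom f")
      case True
      then obtain x u where x: "x \<in> lists A" "f (w @ x) = Some u" by auto
      have "\<exists>x'\<in>lists A. (w @ x) @ x' \<in> dom f" using x by (intro bexI[of _ "[]"]) auto
      then have "\<exists>z\<in>lists A. (w @ x) @ z \<in> dom g" using d words_append[OF w x(1)] by blast
      then obtain z v where z: "z \<in> lists A" "g (w @ x @ z) = Some v" by auto
      have fz: "f (w @ x @ z) = Some (u @ z)" using hom_append[OF f x(2) z(1)] by simp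
      then have "v = u @ z" using z e unfolding hom_ess_equal_def
        by (metis domI IntI option.inject)
      then show ?thesis
        using x z hom_append[OF f fz] hom_append[OF g z(2)] by (intro bexI[of _ "x @ z"]) auto
    next
      case False
      then have "\<not> (\<exists>x\<in>lists A. w @ x \<in> dom g)" using d w by blast
      then show ?thesis using False by (intro bexI[of _ "[]"]) (auto simp: domIff)
    qed
  qed
next
  assume s: "sim A B f g"
  have sub: "\<exists>x\<in>lists A. w @ x \<in> dom g'" if h: "sim A B f' g'" "hom_between A B C f'"
    "hom_between A B C g'" and w: "w \<in> words A B" "x \<in> lists A" "w @ x \<in> dom f'" for f' g' w x
  proof -
    obtain u where u: "f' (w @ x) = Some u" using w(3) by blast
    obtain z where z: "z \<in> lists A" "\<forall>y\<in>lists A. f' ((w @ x) @ z @ y) = g' ((w @ x) @ z @ y)"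
      using simE[OF h(1) words_append[OF w(1,2)]] .
    have "g' (w @ x @ z) = Some (u @ z)" using bspec[OF z(2) lists.Nil] hom_append[OF h(2) u z(1)] by simp
    then show ?thesis using z(1) w(2) by (intro bexI[of _ "x @ z"]) auto
  qed
  have "ess_equal A B (dom f) (dom g)"
    unfolding ess_equal_iff[OF hom_right_ideal(1)[OF f] hom_right_ideal(1)[OF g]]
    using sub[OF s f g] sub[OF sim_sym[OF s] g f] by blast
  moreover have "f w = g w" if w: "w \<in> dom f \<inter> dom g" for w
  proof -
    obtain u v where uv: "f w = Some u" "g w = Some v" using w by auto
    obtain z where z: "z \<in> lists A" "\<forall>y\<in>lists A. f (w @ z @ y) = g (w @ z @ y)"
      using simE[OF s hom_dom[OF f uv(1)]] .
    show ?thesis using bspec[OF z(2) lists.Nil] hom_append[OF f uv(1) z(1)] hom_append[OF g uv(2) z(1)] uv by simp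
  qed
  ultimately show "hom_ess_equal A B f g" unfolding hom_ess_equal_def by blast
qed

section \<open>The maximal extension\<close>

lemma max_map_Some_iff:
  "max_map A B f w = Some u \<longleftrightarrow> w \<in> words A B \<and> u \<in> words A B \<and>
     (\<forall>y\<in>lists A. \<exists>z\<in>lists A. \<forall>z'\<in>lists A. f (w @ y @ z @ z') = Some (u @ y @ z @ z'))"
proof -
  define P where "P u \<longleftrightarrow> u \<in> words A B \<and> (\<forall>y\<in>lists A. \<exists>z\<in>lists A. \<forall>z'\<in>lists A.
       f (w @ y @ z @ z') = Some (u @ y @ z @ z'))" for u
  \<comment> \<open>Two candidates are compared at one extension of w: the witness for v is taken
    below the one for u, and the common suffix cancels.\<close>
  have uniq: "u = v" if "P u" "P v" for u v
  proof -
    have Pu: "\<forall>y\<in>lists A. \<exists>z\<in>lists A. \<forall>z'\<in>lists A. f (w @ y @ z @ z') = Some (u @ y @ z @ z')"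
      and Pv: "\<forall>y\<in>lists A. \<exists>z\<in>lists A. \<forall>z'\<in>lists A. f (w @ y @ z @ z') = Some (v @ y @ z @ z')"
      using that unfolding P_def by simp_all
    obtain z where z: "z \<in> lists A" "\<forall>z'\<in>lists A. f (w @ z @ z') = Some (u @ z @ z')"
      using bspec[OF Pu lists.Nil] by (elim bexE) simp
    obtain z' where z': "z' \<in> lists A" "\<forall>z''\<in>lists A. f (w @ z @ z' @ z'') = Some (v @ z @ z' @ z'')"
      using bspec[OF Pv z(1)] by (elim bexE)
    show "u = v" using bspec[OF z(2) z'(1)] bspec[OF z'(2) lists.Nil] by simp
  qed
  have "max_map A B f w = (if w \<in> words A B \<and> (\<exists>u. P u) then Some (THE u. P u) else None)"
    unfolding max_map_def P_def by (simp add: Bex_def)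
  then have "max_map A B f w = Some u \<longleftrightarrow> w \<in> words A B \<and> P u"
    using uniq the_equality[of P] by (auto split: if_splits)
  then show ?thesis unfolding P_def by blast
qed

lemma max_mapE:
  assumes "max_map A B f w = Some u" "y \<in> lists A"
  obtains z where "z \<in> lists A" "\<forall>z'\<in>lists A. f (w @ y @ z @ z') = Some (u @ y @ z @ z')"
proof -
  have "\<forall>y\<in>lists A. \<exists>z\<in>lists A. \<forall>z'\<in>lists A. f (w @ y @ z @ z') = Some (u @ y @ z @ z')"
    using assms(1) unfolding max_map_Some_iff by simp
  from bspec[OF this assms(2)] show thesis using that by (elim bexE)
qed

text \<open>\<open>max_map\<close> tests its argument only after an extension z of free choice, and
  z can be prolonged until the two maps agree.\<close>

lemma sim_imp_max_map_eq:
  assumes "sim A B f g" shows "max_map A B f = max_map A B g"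
proof -
  have le: "max_map A B g w = Some u" if s: "sim A B f g" and m: "max_map A B f w = Some u" for f g w u
    unfolding max_map_Some_iff
  proof (intro conjI ballI)
    show w: "w \<in> words A B" "u \<in> words A B" using m by (simp_all add: max_map_Some_iff)
    fix y assume y: "y \<in> lists A"
    obtain z where z: "z \<in> lists A" "\<forall>z'\<in>lists A. f (w @ y @ z @ z') = Some (u @ y @ z @ z')"
      using max_mapE[OF m y] .
    have "w @ y @ z \<in> words A B" using w y z by (simp add: words_append)
    then obtain x where x: "x \<in> lists A"
      "\<forall>x'\<in>lists A. f ((w @ y @ z) @ x @ x') = g ((w @ y @ z) @ x @ x')"
      by (rule simE[OF s])
    show "\<exists>z\<in>lists A. \<forall>z'\<in>lists A. g (w @ y @ z @ z') = Some (u @ y @ z @ z')"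
    proof (intro bexI ballI)
      show "z @ x \<in> lists A" using z x by simp
      show "g (w @ y @ (z @ x) @ z') = Some (u @ y @ (z @ x) @ z')" if "z' \<in> lists A" for z'
        using bspec[OF x(2) that] bspec[OF z(2), of "x @ z'"] x(1) that by simp
    qed
  qed
  show ?thesis
  proof
    fix w show "max_map A B f w = max_map A B g w"
      using le[OF assms, of w] le[OF sim_sym[OF assms], of w]
      by (cases "max_map A B f w"; cases "max_map A B g w") simp_all
  qed
qed

lemma hom_le_max_map:
  assumes f: "hom_between A B B f" shows "f \<subseteq>\<^sub>m max_map A B f"
  unfolding map_le_def
proof
  fix w assume "w \<in> dom f"
  then obtain u where u: "f w = Some u" by auto
  have "f (w @ y @ [] @ z') = Some (u @ y @ [] @ z')" if "y \<in> lists A" "z' \<in> lists A" for y z'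
    using hom_append[OF f u, of "y @ z'"] that by simp
  then have "max_map A B f w = Some u" unfolding max_map_Some_iff
    using hom_dom[OF f u] hom_ran[OF f u] lists.Nil by blast
  then show "f w = max_map A B f w" using u by simp
qed

lemma max_map_append:
  assumes w: "max_map A B f w = Some u" and x: "x \<in> lists A"
  shows "max_map A B f (w @ x) = Some (u @ x)"
  unfolding max_map_Some_iff
proof (intro conjI ballI)
  show "w @ x \<in> words A B" "u @ x \<in> words A B"
    using w x by (simp_all add: max_map_Some_iff words_append)
  fix y assume "y \<in> lists A"
  then have "x @ y \<in> lists A" using x by simp
  then obtain z where "z \<in> lists A"
      "\<forall>z'\<in>lists A. f (w @ (x @ y) @ z @ z') = Some (u @ (x @ y) @ z @ z')"
    by (rule max_mapE[OF w])
  then show "\<exists>z\<in>lists A. \<forall>z'\<in>lists A. f ((w @ x) @ y @ z @ z') = Some ((u @ x) @ y @ z @ z')"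
    by (intro bexI[of _ z]) simp_all
qed

lemma hom_max_map:
  assumes f: "hom_between A B B f" shows "hom_between A B B (max_map A B f)"
  unfolding hom_between_def
proof (intro conjI allI impI)
  show "dom (max_map A B f) \<subseteq> words A B" "ran (max_map A B f) \<subseteq> words A B" by (auto simp: ran_def max_map_Some_iff)
  show "\<And>w x u. max_map A B f w = Some u \<Longrightarrow> x \<in> lists A \<Longrightarrow> max_map A B f (w @ x) = Some (u @ x)"
    by (rule max_map_append)
  obtain F where F: "finite F" "dom f = gen A F" "F \<subseteq> dom f" using hom_fg[OF f] .
  \<comment> \<open>Some extension of a word w of the new domain lies in \<open>dom f\<close>, so w
    is comparable with a generator p of \<open>dom f\<close>. Words beyond p are generated by p; the
    others are among the finitely many prefixes of generators.\<close>
  define E where "E = dom (max_map A B f) \<inter> (\<Union>p\<in>F. set (prefixes p))"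
  have le: "dom f \<subseteq> dom (max_map A B f)" using hom_le_max_map[OF f] by (rule map_le_implies_dom_le)
  have "dom (max_map A B f) \<subseteq> gen A E"
  proof
    fix w assume w: "w \<in> dom (max_map A B f)"
    then obtain u where u: "max_map A B f w = Some u" by auto
    obtain z where z: "z \<in> lists A"
      "\<forall>z'\<in>lists A. f (w @ [] @ z @ z') = Some (u @ [] @ z @ z')"
      using max_mapE[OF u lists.Nil] .
    have "f (w @ z) = Some (u @ z)" using bspec[OF z(2) lists.Nil] by simp
    then have "w @ z \<in> gen A F" using F by auto
    then obtain p x where px: "w @ z = p @ x" "p \<in> F" "x \<in> lists A" by (auto elim!: genE)
    consider y where "w = p @ y" "x = y @ z" | "prefix w p"
      using px(1) by (auto simp: append_eq_append_conv2)
    then show "w \<in> gen A E"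
    proof cases
      case 1
      then have "p \<in> E" "y \<in> lists A" using px F le unfolding E_def by auto
      then show ?thesis using 1 genI by blast
    next
      case 2
      then show ?thesis using px w unfolding E_def by (intro gen_base) auto
    qed
  qed
  moreover have "gen A E \<subseteq> dom (max_map A B f)"
    by (auto simp: E_def max_map_append elim!: genE)
  moreover have "finite E" unfolding E_def using F by simp
  ultimately show "\<exists>E. finite E \<and> dom (max_map A B f) = gen A E" by blast
qed

lemma sim_max_map:
  assumes f: "hom_between A B B f" shows "sim A B f (max_map A B f)"
  unfolding sim_def
proof
  fix w assume w: "w \<in> words A B"
  show "\<exists>x\<in>lists A. \<forall>y\<in>lists A. f (w @ x @ y) = max_map A B f (w @ x @ y)"
  proof (cases "\<exists>x\<in>lists A. w @ x \<in> dom (max_map A B f)")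
    case True
    then obtain x u where x: "x \<in> lists A" "max_map A B f (w @ x) = Some u" by auto
    obtain z where z: "z \<in> lists A"
      "\<forall>z'\<in>lists A. f ((w @ x) @ [] @ z @ z') = Some (u @ [] @ z @ z')"
      using max_mapE[OF x(2) lists.Nil] .
    then show ?thesis using x max_map_append[OF x(2)] by (intro bexI[of _ "x @ z"]) auto
  next
    case False
    moreover have "dom f \<subseteq> dom (max_map A B f)" using hom_le_max_map[OF f] by (rule map_le_implies_dom_le)
    ultimately show ?thesis by (intro bexI[of _ "[]"]) (auto simp: domIff)
  qed
qed

text \<open>Any essential extension h of f has the same \<open>max_map\<close> as f and lies below
  it. Thus \<open>max_map A B f\<close> is the greatest essential extension, not just a maximal one,
  which settles the uniqueness in \<open>max_ext\<close>.\<close>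

lemma max_ext_eq_max_map:
  assumes f: "hom_between A B B f" shows "max_ext A B f = max_map A B f"
  unfolding max_ext_def
proof (rule the_equality)
  have ext: "ess_extension A B f (max_map A B f)"
    unfolding ess_extension_def ri_hom_iff
    using hom_max_map[OF f] hom_le_max_map[OF f] sim_max_map[OF f] hom_ess_equal_iff_sim[OF f hom_max_map[OF f]] by blast
  have le: "h \<subseteq>\<^sub>m max_map A B f" if "ess_extension A B f h" for h
  proof -
    have h: "hom_between A B B h" "sim A B f h"
      using that hom_ess_equal_iff_sim[OF f] unfolding ess_extension_def ri_hom_iff by auto
    then show ?thesis using hom_le_max_map[OF h(1)] sim_imp_max_map_eq[OF h(2)] by simp
  qed
  then show "ess_extension A B f (max_map A B f) \<and>
      (\<forall>h. ess_extension A B f h \<and> max_map A B f \<subseteq>\<^sub>m h \<longrightarrow> h = max_map A B f)"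
    using ext map_le_antisym[OF le] by simp
  show "g = max_map A B f" if "ess_extension A B f g \<and> (\<forall>h. ess_extension A B f h \<and> g \<subseteq>\<^sub>m h \<longrightarrow> h = g)" for g
  proof -
    have "g \<subseteq>\<^sub>m max_map A B f" using le that by simp
    then have "max_map A B f = g" using that ext by blast
    then show ?thesis by simp
  qed
qed

lemma max_ext_facts:
  assumes f: "hom_between A B B f"
  shows hom_max_ext: "hom_between A B B (max_ext A B f)"
    and sim_max_ext: "sim A B f (max_ext A B f)"
    and max_ext_idem: "max_ext A B (max_ext A B f) = max_ext A B f"
  unfolding max_ext_eq_max_map[OF f] max_ext_eq_max_map[OF hom_max_map[OF f]]
  using hom_max_map[OF f] sim_max_map[OF f] sim_imp_max_map_eq[OF sim_max_map[OF f]] by simp_all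

text \<open>\<open>max_ext\<close> is a normal form for the classes of \<open>sim\<close>; this
  turns equations in the monoid into statements about compositions.\<close>

lemma max_ext_eq_iff:
  assumes f: "hom_between A B B f" and g: "hom_between A B B g"
  shows "max_ext A B f = max_ext A B g \<longleftrightarrow> sim A B f g"
proof
  assume eq: "max_ext A B f = max_ext A B g"
  have "sim A B f (max_ext A B g)" using sim_max_ext[OF f] eq by simp
  then show "sim A B f g" using sim_trans sim_sym[OF sim_max_ext[OF g]] by blast
next
  assume "sim A B f g"
  then show "max_ext A B f = max_ext A B g"
    unfolding max_ext_eq_max_map[OF f] max_ext_eq_max_map[OF g] by (rule sim_imp_max_map_eq)
qed


section \<open>Prefix codes and factorisations\<close>

text \<open>The free extension of a map on code words: p x goes to t(p) x. The description is
  unambiguous when P is a prefix code, since a word then has only one code word as a prefix.\<close>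

definition ext_hom :: "'a set \<Rightarrow> 'a list set \<Rightarrow> ('a list \<Rightarrow> 'a list) \<Rightarrow> 'a pfun" where
  "ext_hom A P t w = (if w \<in> gen A P
     then Some (THE u. \<exists>p\<in>P. \<exists>x\<in>lists A. w = p @ x \<and> u = t p @ x) else None)"

lemma code_eq:
  assumes "prefix_code A B P" "p \<in> P" "q \<in> P" "p @ x = q @ y"
  shows "p = q"
proof -
  have "prefix p q \<or> prefix q p"
    using assms(4) by (auto simp: append_eq_append_conv2)
  then show ?thesis
    using assms(1-3) unfolding prefix_code_def by (metis prefix_order.le_neq_trans)
qed

lemma ext_hom_append:
  assumes "prefix_code A B P" "p \<in> P" "x \<in> lists A"
  shows "ext_hom A P t (p @ x) = Some (t p @ x)"
proof -
  have "(THE u. \<exists>q\<in>P. \<exists>y\<in>lists A. p @ x = q @ y \<and> u = t q @ y) = t p @ x"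
  proof (rule the_equality)
    show "\<exists>q\<in>P. \<exists>y\<in>lists A. p @ x = q @ y \<and> t p @ x = t q @ y" using assms by metis
    fix u assume "\<exists>q\<in>P. \<exists>y\<in>lists A. p @ x = q @ y \<and> u = t q @ y"
    then obtain q y where qy: "q \<in> P" "p @ x = q @ y" "u = t q @ y" by auto
    with code_eq[OF assms(1,2) qy(1,2)] show "u = t p @ x" by simp
  qed
  then show ?thesis using genI[OF assms(2,3)] unfolding ext_hom_def by simp
qed

lemma dom_ext_hom: "dom (ext_hom A P t) = gen A P"
  by (auto simp: ext_hom_def split: if_splits)

lemma ext_hom_SomeE:
  assumes "prefix_code A B P" "ext_hom A P t w = Some u"
  obtains p x where "p \<in> P" "x \<in> lists A" "w = p @ x" "u = t p @ x"
proof -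
  have "w \<in> gen A P" using domI[of "ext_hom A P t", OF assms(2)] dom_ext_hom[of A P t] by simp
  then obtain p x where px: "w = p @ x" "p \<in> P" "x \<in> lists A" by (rule genE)
  then show thesis using that ext_hom_append[OF assms(1) px(2,3), of t] assms(2) by simp
qed

lemma hom_ext_hom:
  assumes P: "prefix_code A B P" and "finite P" and t: "\<And>p. p \<in> P \<Longrightarrow> t p \<in> words A C"
  shows "hom_between A B C (ext_hom A P t)"
  unfolding hom_between_def
proof (intro conjI allI impI)
  show "dom (ext_hom A P t) \<subseteq> words A B"
    unfolding dom_ext_hom using P by (intro gen_subset_words) (simp add: prefix_code_def)
  show "ran (ext_hom A P t) \<subseteq> words A C"
  proof
    fix u assume "u \<in> ran (ext_hom A P t)"
    then obtain w where w: "ext_hom A P t w = Some u" by (auto simp: ran_def)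
    show "u \<in> words A C" by (rule ext_hom_SomeE[OF P w]) (simp add: t words_append)
  qed
  show "\<exists>F. finite F \<and> dom (ext_hom A P t) = gen A F"
    unfolding dom_ext_hom using assms(2) by blast
  fix w x u assume w: "ext_hom A P t w = Some u" and x: "x \<in> lists A"
  obtain p y where py: "p \<in> P" "y \<in> lists A" "w = p @ y" "u = t p @ y" using ext_hom_SomeE[OF P w] .
  then show "ext_hom A P t (w @ x) = Some (u @ x)" using ext_hom_append[OF P, of p "y @ x" t] x by simp
qed

lemma ex1_code:
  assumes R: "right_ideal A B R" and F: "finite F" "R = gen A F"
  shows "\<exists>!P. finite P \<and> prefix_code A B P \<and> R = gen A P"
proof -
  \<comment> \<open>The code consists of the words of R that are minimal for the prefix order. Such
    words belong to every generating set, which yields finiteness from F and one half of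
    uniqueness.\<close>
  define P where "P = {w \<in> R. \<forall>v\<in>R. \<not> strict_prefix v w}"
  have sub: "R \<subseteq> words A B" using R unfolding right_ideal_def by simp
  have "w \<in> F" if w: "w \<in> P" for w
  proof -
    have "w \<in> gen A F" using w F unfolding P_def by simp
    then obtain p x where px: "w = p @ x" "p \<in> F" "x \<in> lists A" by (rule genE)
    have "p \<in> R" using gen_base[OF px(2)] F by simp
    then have "\<not> strict_prefix p w" using w unfolding P_def by simp
    then show ?thesis using px by (simp add: strict_prefix_def)
  qed
  then have fin: "finite P" using F finite_subset[of P F] by blast
  have code: "prefix_code A B P" unfolding prefix_code_def using sub by (auto simp: P_def)
  have gen: "R = gen A P"
  proof
    show "gen A P \<subseteq> R" using right_ideal_append[OF R] by (auto simp: P_def elim!: genE)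
    have "w \<in> R \<Longrightarrow> w \<in> gen A P" for w
    proof (induction "length w" arbitrary: w rule: less_induct)
      case less
      show ?case
      proof (cases "w \<in> P")
        case True then show ?thesis by (rule gen_base)
      next
        case False
        then obtain v where v: "v \<in> R" "strict_prefix v w" using less.prems unfolding P_def by auto
        then obtain x where x: "w = v @ x" "x \<noteq> []" by (auto simp: strict_prefix_def prefix_def)
        \<comment> \<open>The empty word lies outside \<open>words A B\<close>, so v still contains
          the letter of B and the remainder x is a word over A.\<close>
        have "v \<noteq> []" using v sub unfolding words_def by auto
        then have "x \<in> lists A" using words_prefix[of v x A B] x less.prems sub by auto
        moreover have "v \<in> gen A P" using less.hyps[OF _ v(1)] x by simp
        ultimately show ?thesis using x gen_append by simp
      qed
    qed
    then show "R \<subseteq> gen A P" by (rule subsetI)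
  qed
  have uniq: "Q = P" if Q: "prefix_code A B Q" "R = gen A Q" for Q
  proof (intro equalityI subsetI)
    fix q assume q: "q \<in> Q"
    have "\<not> strict_prefix v q" if "v \<in> R" for v
    proof
      assume sp: "strict_prefix v q"
      have "v \<in> gen A Q" using that Q by simp
      then obtain p x where px: "v = p @ x" "p \<in> Q" "x \<in> lists A" by (rule genE)
      then have "strict_prefix p q" using sp by (auto simp: strict_prefix_def prefix_def)
      then show False using Q(1) px q unfolding prefix_code_def by simp
    qed
    then show "q \<in> P" using gen_base[OF q, of A] Q unfolding P_def by simp
  next
    fix w assume w: "w \<in> P"
    then have "w \<in> gen A Q" using Q unfolding P_def by simp
    then obtain p x where px: "w = p @ x" "p \<in> Q" "x \<in> lists A" by (rule genE)
    have "p \<in> R" using gen_base[OF px(2)] Q by simp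
    then have "\<not> strict_prefix p w" using w unfolding P_def by simp
    then show "w \<in> Q" using px by (simp add: strict_prefix_def)
  qed
  show ?thesis
  proof (rule ex1I[of _ P])
    show "finite P \<and> prefix_code A B P \<and> R = gen A P" using fin code gen by simp
  qed (use uniq in simp)
qed

lemma imC_props:
  assumes u: "hom_between A C B u"
  shows "finite (imC A B u)" and "prefix_code A B (imC A B u)"
    and "ran u = gen A (imC A B u)"
proof -
  obtain F where F: "finite F" "ran u = gen A F" using hom_ran_fg[OF u] .
  have "finite (imC A B u) \<and> prefix_code A B (imC A B u) \<and> ran u = gen A (imC A B u)"
    unfolding imC_def by (rule theI'[OF ex1_code[OF hom_right_ideal(2)[OF u] F]])
  then show "finite (imC A B u)" "prefix_code A B (imC A B u)" "ran u = gen A (imC A B u)" by simp_all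
qed

text \<open>Besides the size, density in the old ideal is carried through the induction: a refined
  code must still describe the same ideal up to essential equality.\<close>

lemma expand_code:
  assumes A: "finite A" "A \<noteq> {}" and P: "finite P" "prefix_code A B P" "P \<noteq> {}"
  shows "\<exists>S. finite S \<and> prefix_code A B S \<and> S \<noteq> {} \<and> card S = card P + m * (card A - 1) \<and>
    gen A S \<subseteq> gen A P \<and> (\<forall>w\<in>gen A P. \<exists>x\<in>lists A. w @ x \<in> gen A S)"
proof (induction m)
  case 0
  have "\<forall>w\<in>gen A P. \<exists>x\<in>lists A. w @ x \<in> gen A P"
  proof
    fix w assume "w \<in> gen A P"
    then show "\<exists>x\<in>lists A. w @ x \<in> gen A P" by (intro bexI[of _ "[]"]) auto
  qed
  then show ?case using P by (intro exI[of _ P]) simp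
next
  case (Suc m)
  then obtain S where S: "finite S" "prefix_code A B S" "S \<noteq> {}" "card S = card P + m * (card A - 1)"
    "gen A S \<subseteq> gen A P" "\<forall>w\<in>gen A P. \<exists>x\<in>lists A. w @ x \<in> gen A S" by auto
  obtain p where p: "p \<in> S" using S(3) by auto
  obtain a where a: "a \<in> A" using A(2) by auto
  define N where "N = (\<lambda>a. p @ [a]) ` A"
  define T where "T = (S - {p}) \<union> N"
  have Sw: "S \<subseteq> words A B" and Sp: "\<And>q r. q \<in> S \<Longrightarrow> r \<in> S \<Longrightarrow> \<not> strict_prefix q r"
    using S(2) unfolding prefix_code_def by simp_all
  have "N \<inter> S = {}" using Sp[OF p] by (force simp: N_def strict_prefix_def prefix_def)
  moreover have "card N = card A" unfolding N_def by (intro card_image) (simp add: inj_on_def)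
  moreover have "card (S - {p}) = card S - 1" using p S(1) by simp
  moreover have "card S > 0" using S(1,3) by (simp add: card_gt_0_iff)
  moreover have "card A > 0" using A by (simp add: card_gt_0_iff)
  moreover have "finite N" unfolding N_def using A by simp
  moreover have "card T = card (S - {p}) + card N"
    unfolding T_def using S(1) \<open>finite N\<close> \<open>N \<inter> S = {}\<close> by (intro card_Un_disjoint) auto
  ultimately have "card T = card S + (card A - 1)" "finite T" using S(1) by (simp_all add: T_def)
  moreover have "prefix_code A B T" unfolding prefix_code_def
  proof (intro conjI ballI)
    show "T \<subseteq> words A B" unfolding T_def N_def using Sw p by (auto intro!: words_append)
    fix q r assume qr: "q \<in> T" "r \<in> T"
    show "\<not> strict_prefix q r"
    proof
      assume sp: "strict_prefix q r"
      have pq: "strict_prefix p r" if "q \<in> N"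
        using that sp by (auto simp: N_def strict_prefix_def prefix_def)
      show False
      proof (cases "r \<in> N")
        case False
        then have "r \<in> S" using qr unfolding T_def by simp
        then show False using Sp[of q r] Sp[OF p, of r] pq sp qr unfolding T_def by auto
      next
        case True
        then obtain c where "r = p @ [c]" unfolding N_def by auto
        then have "prefix q p" using sp by (auto simp: strict_prefix_def)
        moreover have "q \<in> S \<and> q \<noteq> p"
          using qr \<open>prefix q p\<close> unfolding T_def N_def by (auto simp: prefix_def)
        ultimately show False using Sp[of q p] p by (simp add: strict_prefix_def)
      qed
    qed
  qed
  moreover have "T \<noteq> {}" using a unfolding T_def N_def by auto
  moreover have "gen A T \<subseteq> gen A S"
  proof
    fix w assume "w \<in> gen A T"
    then obtain q x where q: "w = q @ x" "q \<in> T" "x \<in> lists A" by (rule genE)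
    show "w \<in> gen A S"
    proof (cases "q \<in> N")
      case True
      then obtain c where "q = p @ [c]" "c \<in> A" unfolding N_def by auto
      then show ?thesis using genI[OF p, of "c # x" A] q by simp
    next
      case False
      then show ?thesis using q genI[of q S x A] unfolding T_def by simp
    qed
  qed
  moreover have "\<exists>x\<in>lists A. w @ x \<in> gen A T" if w: "w \<in> gen A P" for w
  proof -
    obtain x where x: "x \<in> lists A" "w @ x \<in> gen A S" using bspec[OF S(6) w] by (elim bexE)
    obtain q y where qy: "w @ x = q @ y" "q \<in> S" "y \<in> lists A" using x(2) by (rule genE)
    \<comment> \<open>The extra letter matters when w @ x is p itself: the refined code reaches only
      proper extensions of p, and a provides one.\<close>
    have wxa: "w @ (x @ [a]) = q @ (y @ [a])" using qy(1) by (simp flip: append_assoc)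
    have "w @ (x @ [a]) \<in> gen A T"
    proof (cases "q = p")
      case True
      obtain c z where cz: "y @ [a] = c # z" "c \<in> A" "z \<in> lists A"
        using qy(3) a by (cases y) auto
      then have "w @ (x @ [a]) = (p @ [c]) @ z" "p @ [c] \<in> T" using wxa True cz unfolding T_def N_def by auto
      then show ?thesis using genI[of "p @ [c]" T z A] \<open>z \<in> lists A\<close> by simp
    next
      case False
      then have "q \<in> T" using qy unfolding T_def by simp
      then show ?thesis unfolding wxa using qy a by (intro genI) simp_all
    qed
    then show ?thesis using x a by (intro bexI[of _ "x @ [a]"]) auto
  qed
  ultimately show ?case using S(4,5) by (intro exI[of _ T]) auto
qed

text \<open>Refinement can only enlarge a code, so congruent sizes are made equal by enlarging on
  both sides.\<close>

lemma cong_imp_add_multiples_eq: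
  fixes m n k :: nat
  assumes "[m = n] (mod k)" shows "\<exists>c d. m + c * k = n + d * k"
proof (cases "n \<le> m")
  case True
  then obtain q where "m = q * k + n" using assms cong_le_nat by metis
  then show ?thesis by (intro exI[of _ 0] exI[of _ q]) simp
next
  case False
  then obtain q where "n = q * k + m" using cong_sym[OF assms] cong_le_nat[of m n k] by auto
  then show ?thesis by (intro exI[of _ q] exI[of _ 0]) simp
qed

lemma prefix_code_letters: "prefix_code A B ((\<lambda>b. [b]) ` B)"
  unfolding prefix_code_def words_def by (auto simp: strict_prefix_def)

text \<open>The single letters form a code that generates all of \<open>words A B\<close>. This code
  and Q are refined to a common size, and a bijection between the refined codes extends to
  homomorphisms in both directions. The refined ideals are dense in \<open>words A B\<close> and in
  \<open>gen A Q\<close>; hence \<alpha> has a left inverse, while \<alpha>\<alpha>' is the identity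
  only densely below Q.\<close>

lemma code_retract:
  assumes A: "finite A" "A \<noteq> {}" and B: "finite B" "B \<noteq> {}"
    and Q: "finite Q" "prefix_code A C Q" "Q \<noteq> {}" and "[card Q = card B] (mod (card A - 1))"
  obtains \<alpha> \<alpha>' where "hom_between A B C \<alpha>" "hom_between A C B \<alpha>'" "sim A B (\<alpha>' \<circ>\<^sub>m \<alpha>) (id_on A B)"
    "ran \<alpha> \<subseteq> gen A Q" "\<forall>w\<in>gen A Q. \<exists>x\<in>lists A. (\<alpha> \<circ>\<^sub>m \<alpha>') (w @ x) = Some (w @ x)"
proof -
  let ?L = "(\<lambda>b. [b]) ` B"
  have "card ?L = card B" by (intro card_image) (simp add: inj_on_def)
  then obtain c d where cd: "card Q + c * (card A - 1) = card ?L + d * (card A - 1)"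
    using cong_imp_add_multiples_eq[OF assms(8)] by auto
  obtain S where S: "finite S" "prefix_code A B S" "card S = card ?L + d * (card A - 1)"
     "\<forall>w\<in>gen A ?L. \<exists>x\<in>lists A. w @ x \<in> gen A S"
    using expand_code[OF A _ prefix_code_letters[of A B], of d] B by auto
  obtain T where T: "finite T" "prefix_code A C T" "card T = card Q + c * (card A - 1)"
     "gen A T \<subseteq> gen A Q" "\<forall>w\<in>gen A Q. \<exists>x\<in>lists A. w @ x \<in> gen A T"
    using expand_code[OF A Q, of c] by auto
  obtain \<theta> where \<theta>: "bij_betw \<theta> S T" using finite_same_card_bij[OF S(1) T(1)] S(3) T(3) cd by auto
  define \<alpha> where "\<alpha> = ext_hom A S \<theta>"
  define \<alpha>' where "\<alpha>' = ext_hom A T (inv_into S \<theta>)"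
  have ST: "\<theta> s \<in> T" "inv_into S \<theta> (\<theta> s) = s" if "s \<in> S" for s
    using that \<theta> by (auto simp: bij_betw_def)
  have TS: "inv_into S \<theta> t \<in> S" "\<theta> (inv_into S \<theta> t) = t" if "t \<in> T" for t
    using that \<theta> by (auto simp: bij_betw_def inv_into_into f_inv_into_f)
  have \<alpha>: "\<alpha> (s @ x) = Some (\<theta> s @ x)" if "s \<in> S" "x \<in> lists A" for s x
    unfolding \<alpha>_def using ext_hom_append[OF S(2) that] .
  have \<alpha>': "\<alpha>' (t @ x) = Some (inv_into S \<theta> t @ x)" if "t \<in> T" "x \<in> lists A" for t x
    unfolding \<alpha>'_def using ext_hom_append[OF T(2) that] .
  have Sw: "S \<subseteq> words A B" and Tw: "T \<subseteq> words A C"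
    using S(2) T(2) unfolding prefix_code_def by simp_all
  show thesis
  proof (rule that)
    show "hom_between A B C \<alpha>" unfolding \<alpha>_def using S ST Tw by (intro hom_ext_hom) auto
    show "hom_between A C B \<alpha>'" unfolding \<alpha>'_def using T TS Sw by (intro hom_ext_hom) auto
    show "sim A B (\<alpha>' \<circ>\<^sub>m \<alpha>) (id_on A B)" unfolding sim_def
    proof
      fix w assume w: "w \<in> words A B"
      then obtain x where x: "x \<in> lists A" "w @ x \<in> gen A S" using S(4) unfolding words_eq_gen[symmetric] by auto
      have "(\<alpha>' \<circ>\<^sub>m \<alpha>) (w @ x @ y) = id_on A B (w @ x @ y)" if y: "y \<in> lists A" for y
      proof -
        have "w @ x @ y \<in> gen A S" using gen_append[OF x(2) y] by simp
        then obtain s z where sz: "w @ x @ y = s @ z" "s \<in> S" "z \<in> lists A" by (rule genE)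
        have "(\<alpha>' \<circ>\<^sub>m \<alpha>) (s @ z) = Some (s @ z)" using \<alpha>[OF sz(2,3)] \<alpha>'[OF ST(1) sz(3)] ST sz by simp
        moreover have "w @ x @ y \<in> words A B" using w x y by (simp add: words_append)
        ultimately show ?thesis using sz(1) unfolding id_on_def by simp
      qed
      then show "\<exists>x\<in>lists A. \<forall>y\<in>lists A. (\<alpha>' \<circ>\<^sub>m \<alpha>) (w @ x @ y) = id_on A B (w @ x @ y)"
        using x(1) by auto
    qed
    show "ran \<alpha> \<subseteq> gen A Q"
    proof
      fix u assume "u \<in> ran \<alpha>"
      then obtain w where "ext_hom A S \<theta> w = Some u" by (auto simp: ran_def \<alpha>_def)
      then obtain s x where "s \<in> S" "x \<in> lists A" "u = \<theta> s @ x" by (rule ext_hom_SomeE[OF S(2)])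
      then show "u \<in> gen A Q" using genI[OF ST(1)] T(4) by auto
    qed
    show "\<forall>w\<in>gen A Q. \<exists>x\<in>lists A. (\<alpha> \<circ>\<^sub>m \<alpha>') (w @ x) = Some (w @ x)"
    proof
      fix w assume "w \<in> gen A Q"
      then obtain x where x: "x \<in> lists A" "w @ x \<in> gen A T" using T(5) by auto
      then obtain t z where tz: "w @ x = t @ z" "t \<in> T" "z \<in> lists A" by (elim genE)
      have "(\<alpha> \<circ>\<^sub>m \<alpha>') (t @ z) = Some (t @ z)" using \<alpha>'[OF tz(2,3)] \<alpha>[OF TS(1) tz(3)] TS tz by simp
      then show "\<exists>x\<in>lists A. (\<alpha> \<circ>\<^sub>m \<alpha>') (w @ x) = Some (w @ x)"
        unfolding tz(1)[symmetric] using x(1) by (intro bexI[of _ x])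
    qed
  qed
qed

text \<open>Up to refinement the image of u is a copy of \<open>words A B\<close>, embedded by
  \<alpha>. Since \<alpha>' undoes \<alpha>, the other factor has to be \<alpha>'u; its right
  inverse comes from preimages of the code words of the image.\<close>

lemma hom_factor:
  assumes A: "finite A" "A \<noteq> {}" and B: "finite B" "B \<noteq> {}"
    and u: "hom_between A C D u" "u \<noteq> Map.empty" and "[card (imC A D u) = card B] (mod (card A - 1))"
  obtains \<alpha> \<alpha>' \<beta> \<beta>' where "hom_between A B D \<alpha>" "hom_between A D B \<alpha>'"
    "hom_between A C B \<beta>" "hom_between A B C \<beta>'"
    "sim A B (\<alpha>' \<circ>\<^sub>m \<alpha>) (id_on A B)" "sim A B (\<beta> \<circ>\<^sub>m \<beta>') (id_on A B)" "sim A C (\<alpha> \<circ>\<^sub>m \<beta>) u"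
proof -
  define Q where "Q = imC A D u"
  have Q: "finite Q" "prefix_code A D Q" "ran u = gen A Q" using imC_props[OF u(1)] unfolding Q_def by simp_all
  have "Q \<noteq> {}"
  proof
    assume "Q = {}"
    then have "ran u = {}" using Q unfolding gen_def by simp
    then have "u w = None" for w using ranI[of u w] by (cases "u w") auto
    then show False using u(2) by auto
  qed
  obtain \<alpha> \<alpha>' where \<alpha>: "hom_between A B D \<alpha>" "hom_between A D B \<alpha>'" "sim A B (\<alpha>' \<circ>\<^sub>m \<alpha>) (id_on A B)"
    "ran \<alpha> \<subseteq> gen A Q" "\<forall>w\<in>gen A Q. \<exists>x\<in>lists A. (\<alpha> \<circ>\<^sub>m \<alpha>') (w @ x) = Some (w @ x)"
    using code_retract[OF A B Q(1,2) \<open>Q \<noteq> {}\<close> assms(7)[folded Q_def]] .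
  \<comment> \<open>One preimage for each code word of the image. A prefix code is free, so the
    choice extends to a homomorphism \<rho>, a section of u over its image.\<close>
  define r where "r q = (SOME w. u w = Some q)" for q
  have r: "u (r q) = Some q" if "q \<in> Q" for q
  proof -
    have "q \<in> ran u" using that gen_base Q(3) by simp
    then have "\<exists>w. u w = Some q" by (auto simp: ran_def)
    then show ?thesis unfolding r_def by (rule someI_ex)
  qed
  define \<rho> where "\<rho> = ext_hom A Q r"
  have \<rho>: "hom_between A D C \<rho>" unfolding \<rho>_def using Q r hom_dom[OF u(1)] by (intro hom_ext_hom) auto
  have u\<rho>: "u \<circ>\<^sub>m (\<rho> \<circ>\<^sub>m \<alpha>) = \<alpha>"
  proof
    fix w show "(u \<circ>\<^sub>m (\<rho> \<circ>\<^sub>m \<alpha>)) w = \<alpha> w"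
    proof (cases "\<alpha> w")
      case None then show ?thesis by (simp add: map_comp_def)
    next
      case (Some v)
      then have "v \<in> gen A Q" using \<alpha>(4) by (auto intro: ranI)
      then obtain q x where qx: "v = q @ x" "q \<in> Q" "x \<in> lists A" by (rule genE)
      have "\<rho> v = Some (r q @ x)" unfolding \<rho>_def qx(1) using ext_hom_append[OF Q(2) qx(2,3)] .
      moreover have "u (r q @ x) = Some v" using hom_append[OF u(1) r[OF qx(2)] qx(3)] qx(1) by simp
      ultimately show ?thesis using Some by simp
    qed
  qed
  show thesis
  proof (rule that[of \<alpha> \<alpha>' "\<alpha>' \<circ>\<^sub>m u" "\<rho> \<circ>\<^sub>m \<alpha>"])
    show "hom_between A C B (\<alpha>' \<circ>\<^sub>m u)" using hom_comp[OF u(1) \<alpha>(2)] .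
    show "hom_between A B C (\<rho> \<circ>\<^sub>m \<alpha>)" using hom_comp[OF \<alpha>(1) \<rho>] .
    show "sim A B ((\<alpha>' \<circ>\<^sub>m u) \<circ>\<^sub>m (\<rho> \<circ>\<^sub>m \<alpha>)) (id_on A B)" unfolding map_comp_assoc u\<rho> by (rule \<alpha>(3))
    have \<alpha>\<alpha>: "hom_between A D D (\<alpha> \<circ>\<^sub>m \<alpha>')" using hom_comp[OF \<alpha>(2,1)] .
    \<comment> \<open>\<alpha>\<alpha>' is the identity densely on the image of u, and extending a
      word of the domain extends its value alike; below words that never reach the domain both sides
      are undefined.\<close>
    have "sim A C ((\<alpha> \<circ>\<^sub>m \<alpha>') \<circ>\<^sub>m u) u" unfolding sim_def
    proof
      fix w assume w: "w \<in> words A C"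
      show "\<exists>x\<in>lists A. \<forall>y\<in>lists A. ((\<alpha> \<circ>\<^sub>m \<alpha>') \<circ>\<^sub>m u) (w @ x @ y) = u (w @ x @ y)"
      proof (cases "\<exists>x\<in>lists A. w @ x \<in> dom u")
        case True
        then obtain x v where x: "x \<in> lists A" "u (w @ x) = Some v" by auto
        have "v \<in> gen A Q" using ranI[of u, OF x(2)] Q(3) by simp
        then obtain z where z: "z \<in> lists A" "(\<alpha> \<circ>\<^sub>m \<alpha>') (v @ z) = Some (v @ z)" using \<alpha>(5) by auto
        have "((\<alpha> \<circ>\<^sub>m \<alpha>') \<circ>\<^sub>m u) (w @ (x @ z) @ y) = u (w @ (x @ z) @ y)" if y: "y \<in> lists A" for y
        proof -
          have "u (w @ (x @ z) @ y) = Some ((v @ z) @ y)" using hom_append[OF u(1) x(2), of "z @ y"] z y by simp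
          then show ?thesis using hom_append[OF \<alpha>\<alpha> z(2) y] by (simp add: map_comp_def)
        qed
        then show ?thesis using x z by (intro bexI[of _ "x @ z"]) auto
      next
        case False
        then have "u (w @ [] @ y) = None" if "y \<in> lists A" for y using that by (simp add: domIff)
        then show ?thesis by (intro bexI[of _ "[]"]) (auto simp: map_comp_def)
      qed
    qed
    then show "sim A C (\<alpha> \<circ>\<^sub>m (\<alpha>' \<circ>\<^sub>m u)) u" unfolding map_comp_assoc .
  qed (use \<alpha> in auto)
qed


section \<open>Counting: isomorphisms and the number of letters\<close>

lemma card_words_length:
  assumes "finite A" "finite B"
  shows "finite {w \<in> words A B. length w = Suc n}"
    and "card {w \<in> words A B. length w = Suc n} = card B * card A ^ n"
proof -
  let ?L = "{xs. set xs \<subseteq> A \<and> length xs = n}"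
  have eq: "{w \<in> words A B. length w = Suc n} = (\<lambda>(b, x). b # x) ` (B \<times> ?L)"
    unfolding words_def lists_eq_set by auto
  have "inj_on (\<lambda>(b, x). b # x) (B \<times> ?L)" by (auto simp: inj_on_def)
  then show "card {w \<in> words A B. length w = Suc n} = card B * card A ^ n"
    unfolding eq by (simp add: card_image card_cartesian_product card_lists_length_eq assms)
  show "finite {w \<in> words A B. length w = Suc n}"
    unfolding eq using assms finite_lists_length_eq by blast
qed

lemma cong_power_pred:
  fixes k n :: nat
  assumes "k \<ge> 1" shows "[k ^ n = 1] (mod (k - 1))"
proof -
  have "[k = 1] (mod (k - 1))" using assms cong_le_nat[of 1 k "k - 1"] by (auto intro: exI[of _ 1])
  then have "[k ^ n = 1 ^ n] (mod (k - 1))" by (rule cong_pow)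
  then show ?thesis by simp
qed

text \<open>Words longer than all of T are counted twice, freely and by their unique prefix in T.
  With one letter of B followed by N letters of A this reads |B| k^N = sum of k^(N+1-|t|) over T,
  and every power of k is 1 modulo k - 1.\<close>

lemma complete_code_card:
  assumes A: "finite A" "A \<noteq> {}" and B: "finite B" and T: "finite T" "prefix_code A B T"
    and dense: "\<forall>w\<in>words A B. \<exists>x\<in>lists A. w @ x \<in> gen A T"
  shows "[card T = card B] (mod (card A - 1))"
proof -
  obtain N where N: "\<forall>t\<in>T. length t < N" using finite_maxlen[OF T(1)] by auto
  define E where "E t = {x \<in> lists A. length x = Suc N - length t}" for t :: "'a list"
  have E: "E t = {xs. set xs \<subseteq> A \<and> length xs = Suc N - length t}" for t
    unfolding E_def lists_eq_set by simp
  have finE: "finite (E t)" for t unfolding E by (rule finite_lists_length_eq[OF A(1)])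
  have cardE: "card (E t) = card A ^ (Suc N - length t)" for t unfolding E by (rule card_lists_length_eq[OF A(1)])
  have Tw: "T \<subseteq> words A B" using T(2) unfolding prefix_code_def by simp
  have eq: "{w \<in> words A B. length w = Suc N} = (\<Union>t\<in>T. (@) t ` E t)"
  proof (intro equalityI subsetI)
    fix w assume w: "w \<in> {w \<in> words A B. length w = Suc N}"
    then obtain x where x: "x \<in> lists A" "w @ x \<in> gen A T" using dense by auto
    then obtain t z where tz: "w @ x = t @ z" "t \<in> T" "z \<in> lists A" by (elim genE)
    have lt: "length t < length w" using N tz(2) w by force
    then obtain y where y: "w = t @ y" using tz(1) by (auto simp: append_eq_append_conv2)
    have "t \<noteq> []" using tz(2) Tw unfolding words_def by auto
    then have "y \<in> lists A" using words_prefix[of t y A B] w y by simp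
    then have "y \<in> E t" using w y unfolding E_def by auto
    then show "w \<in> (\<Union>t\<in>T. (@) t ` E t)" using tz(2) y by blast
  next
    fix w assume "w \<in> (\<Union>t\<in>T. (@) t ` E t)"
    then obtain t y where ty: "t \<in> T" "y \<in> E t" "w = t @ y" by blast
    have "length t < N" using N ty by simp
    then show "w \<in> {w \<in> words A B. length w = Suc N}"
      using ty Tw unfolding E_def by (auto intro!: words_append)
  qed
  have "card {w \<in> words A B. length w = Suc N} = (\<Sum>t\<in>T. card ((@) t ` E t))"
    unfolding eq
  proof (rule card_UN_disjoint[OF T(1)])
    show "\<forall>t\<in>T. finite ((@) t ` E t)" using finE by simp
    show "\<forall>s\<in>T. \<forall>t\<in>T. s \<noteq> t \<longrightarrow> (@) s ` E s \<inter> (@) t ` E t = {}"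
    proof (intro ballI impI)
      fix s t assume st: "s \<in> T" "t \<in> T" "s \<noteq> t"
      have "s @ x \<noteq> t @ y" for x y using code_eq[OF T(2) st(1,2)] st(3) by auto
      then show "(@) s ` E s \<inter> (@) t ` E t = {}" by auto
    qed
  qed
  also have "\<dots> = (\<Sum>t\<in>T. card A ^ (Suc N - length t))"
    by (intro sum.cong refl) (simp add: card_image cardE inj_on_def)
  finally have sum: "card B * card A ^ N = (\<Sum>t\<in>T. card A ^ (Suc N - length t))"
    using card_words_length(2)[OF A(1) B, of N] by simp
  have k: "card A \<ge> 1" using A by (simp add: Suc_le_eq card_gt_0_iff)
  have "[(\<Sum>t\<in>T. card A ^ (Suc N - length t)) = (\<Sum>t\<in>T. 1)] (mod (card A - 1))"
    by (intro cong_sum cong_power_pred k)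
  moreover have "[card B * card A ^ N = card B * 1] (mod (card A - 1))"
    by (intro cong_mult cong_refl cong_power_pred k)
  ultimately show ?thesis using sum by (simp add: cong_def)
qed

lemma sim_id_on:
  assumes "sim A B f (id_on A B)" "w \<in> words A B"
  obtains x where "x \<in> lists A" "\<forall>y\<in>lists A. f (w @ x @ y) = Some (w @ x @ y)"
proof -
  obtain x where x: "x \<in> lists A" "\<forall>y\<in>lists A. f (w @ x @ y) = id_on A B (w @ x @ y)"
    using simE[OF assms] .
  have "\<forall>y\<in>lists A. f (w @ x @ y) = Some (w @ x @ y)"
    using x assms(2) by (simp add: id_on_def words_append)
  then show thesis using that x(1) by simp
qed

text \<open>A value of a homomorphism is determined by the value at any extension, because suffixes
  cancel. So the homomorphisms in the class of the identity are restrictions of it.\<close>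

lemma sim_id_on_Some:
  assumes "sim A B f (id_on A B)" "hom_between A B B f" "f w = Some u"
  shows "u = w"
proof -
  obtain x where x: "x \<in> lists A" "\<forall>y\<in>lists A. f (w @ x @ y) = Some (w @ x @ y)"
    using sim_id_on[OF assms(1) hom_dom[OF assms(2,3)]] .
  show ?thesis using bspec[OF x(2) lists.Nil] hom_append[OF assms(2,3) x(1)] by simp
qed

text \<open>Density by itself would allow arbitrarily long words outside the domain. Finite
  generation excludes them: a word longer than all generators, with an extension in the domain,
  already extends a generator.\<close>

lemma sim_id_on_long:
  assumes f: "sim A B f (id_on A B)" "hom_between A B B f"
  obtains N where "\<And>w. w \<in> words A B \<Longrightarrow> N \<le> length w \<Longrightarrow> f w = Some w"
proof -
  obtain F where F: "finite F" "dom f = gen A F" "F \<subseteq> dom f" using hom_fg[OF f(2)] .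
  obtain N where N: "\<forall>t\<in>F. length t < N" using finite_maxlen[OF F(1)] by auto
  have "f w = Some w" if w: "w \<in> words A B" "N \<le> length w" for w
  proof -
    obtain x where x: "x \<in> lists A" "\<forall>y\<in>lists A. f (w @ x @ y) = Some (w @ x @ y)"
      using sim_id_on[OF f(1) w(1)] .
    have "w @ x \<in> gen A F" using domI[of f, OF bspec[OF x(2) lists.Nil]] F(2) by simp
    then obtain t z where tz: "w @ x = t @ z" "t \<in> F" "z \<in> lists A" by (rule genE)
    have "length t < length w" using N tz(2) w by force
    then obtain y where y: "w = t @ y" using tz(1) by (auto simp: append_eq_append_conv2)
    have "y \<in> lists A" using tz(1,3) y by auto
    moreover obtain u where u: "f t = Some u" using tz(2) F(3) by auto
    ultimately have "f w = Some (u @ y)" using hom_append[OF f(2) u] y by simp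
    then show ?thesis using sim_id_on_Some[OF f] by simp
  qed
  then show thesis by (rule that)
qed

text \<open>The words of length \<open>Suc N\<close> form a complete code of size |B| k^N on which
  dc is literally the identity. Their image under c is a complete code on the other side, so
  \<open>complete_code_card\<close> computes its size modulo k - 1 a second time.\<close>

lemma iso_card:
  assumes A: "finite A" "A \<noteq> {}" and B: "finite B" and C: "finite C"
    and c: "hom_between A B C c" and d: "hom_between A C B d"
    and dc: "sim A B (d \<circ>\<^sub>m c) (id_on A B)" and cd: "sim A C (c \<circ>\<^sub>m d) (id_on A C)"
  shows "[card B = card C] (mod (card A - 1))"
proof -
  obtain N where N: "\<And>w. w \<in> words A B \<Longrightarrow> N \<le> length w \<Longrightarrow> (d \<circ>\<^sub>m c) w = Some w"
    using sim_id_on_long[OF dc hom_comp[OF c d]] by metis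
  define S where "S = {w \<in> words A B. length w = Suc N}"
  define t where "t w = the (c w)" for w
  have t: "c w = Some (t w)" "d (t w) = Some w" if "w \<in> S" for w
    using N[of w] that unfolding S_def t_def by (auto simp: map_comp_Some_iff)
  define T where "T = t ` S"
  have S: "finite S" "card S = card B * card A ^ N"
    using card_words_length[OF A(1) B, of N] unfolding S_def by simp_all
  have "inj_on t S" using t(2) by (metis inj_onI option.inject)
  then have cardT: "card T = card B * card A ^ N" "finite T"
    using S unfolding T_def by (simp_all add: card_image)
  have Tw: "T \<subseteq> words A C" unfolding T_def using t(1) hom_ran[OF c] by auto
  have "prefix_code A C T" unfolding prefix_code_def
  proof (intro conjI Tw ballI notI)
    \<comment> \<open>The map d transports prefixes back: if q = p z, then w = v z, and the equal
      lengths of v and w leave no room for a nonempty z.\<close>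
    fix p q assume "p \<in> T" "q \<in> T" and sp: "strict_prefix p q"
    then obtain v w where v: "v \<in> S" "p = t v" and w: "w \<in> S" "q = t w" unfolding T_def by auto
    obtain z where z: "q = p @ z" "z \<noteq> []" using sp by (auto simp: strict_prefix_def prefix_def)
    have "p \<in> words A C" "q \<in> words A C" using Tw \<open>p \<in> T\<close> \<open>q \<in> T\<close> by auto
    then have "z \<in> lists A" using words_prefix[of p z A C] z by (auto simp: words_def)
    then have "d q = Some (v @ z)" using hom_append[OF d t(2)[OF v(1)]] v z by simp
    then have "w = v @ z" using t(2)[OF w(1)] w by simp
    then show False using v w z unfolding S_def by simp
  qed
  moreover have "\<forall>v\<in>words A C. \<exists>x\<in>lists A. v @ x \<in> gen A T"
  proof
    fix v assume v: "v \<in> words A C"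
    obtain x where x: "x \<in> lists A" "\<forall>y\<in>lists A. (c \<circ>\<^sub>m d) (v @ x @ y) = Some (v @ x @ y)"
      using sim_id_on[OF cd v] .
    then obtain u where u: "d (v @ x) = Some u" "c u = Some (v @ x)"
      using bspec[OF x(2) lists.Nil] by (auto simp: map_comp_Some_iff)
    obtain a where a: "a \<in> A" using A by auto
    \<comment> \<open>A suffix of length \<open>Suc N\<close> makes u @ y long enough to have a
      prefix in S, however short u is; c then sends u @ y to an extension of v that begins with a
      word of T.\<close>
    define y where "y = replicate (Suc N) a"
    have y: "y \<in> lists A" "length y = Suc N" using a unfolding y_def lists_eq_set by auto
    have uw: "u \<in> words A B" using hom_dom[OF c u(2)] .
    define s where "s = take (Suc N) (u @ y)"
    define z where "z = drop (Suc N) (u @ y)"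
    have sz: "u @ y = s @ z" unfolding s_def z_def by (rule append_take_drop_id[symmetric])
    have len: "length s = Suc N" unfolding s_def using y by simp
    have "s \<in> words A B \<and> z \<in> lists A"
      using words_prefix[of s z A B] words_append[OF uw y(1)] sz len by (cases s) simp_all
    then have s: "s \<in> S" "z \<in> lists A" unfolding S_def using len by simp_all
    have "c (u @ y) = Some (v @ x @ y)" using hom_append[OF c u(2) y(1)] by simp
    moreover have "c (s @ z) = Some (t s @ z)" using hom_append[OF c t(1)[OF s(1)] s(2)] .
    ultimately have "v @ x @ y = t s @ z" using sz by simp
    then have "v @ (x @ y) \<in> gen A T" using genI[of "t s" T z A] s unfolding T_def by simp
    then show "\<exists>x\<in>lists A. v @ x \<in> gen A T" using x(1) y(1) by (intro bexI[of _ "x @ y"]) auto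
  qed
  ultimately have "[card T = card C] (mod (card A - 1))"
    using complete_code_card[OF A C cardT(2)] by simp
  moreover have "[card T = card B * 1] (mod (card A - 1))" unfolding cardT(1)
    using A by (intro cong_mult cong_refl cong_power_pred) (simp add: Suc_le_eq card_gt_0_iff)
  ultimately show ?thesis by (simp add: cong_def)
qed

text \<open>Injectivity and essentiality say that the set-theoretic inverse is a homomorphism with
  dense domain and that f itself is densely defined. Conversely, an inverse modulo
  \<open>sim\<close> recovers both, since values at extensions determine the values before them.
  Thus the isomorphisms are the units modulo \<open>sim\<close>.\<close>

lemma ri_iso_iff:
  "ri_iso A B f \<longleftrightarrow> hom_between A B B f \<and> (\<exists>g. hom_between A B B g \<and>
     sim A B (g \<circ>\<^sub>m f) (id_on A B) \<and> sim A B (f \<circ>\<^sub>m g) (id_on A B))"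
proof
  assume "ri_iso A B f"
  then have f: "hom_between A B B f" and inj: "inj_on f (dom f)"
    and ess: "essential A B (dom f)" "essential A B (ran f)"
    unfolding ri_iso_def ri_hom_iff by simp_all
  have d: "\<forall>w\<in>words A B. \<exists>x\<in>lists A. w @ x \<in> dom f" "\<forall>w\<in>words A B. \<exists>x\<in>lists A. w @ x \<in> ran f"
    using ess unfolding essential_iff[OF hom_right_ideal(1)[OF f]] essential_iff[OF hom_right_ideal(2)[OF f]] .
  define g where "g v = (if v \<in> ran f then Some (SOME w. f w = Some v) else None)" for v
  have g: "g v = Some w \<longleftrightarrow> f w = Some v" for v w
  proof
    assume "g v = Some w"
    then have "v \<in> ran f" "w = (SOME w. f w = Some v)" unfolding g_def by (auto split: if_splits)
    then show "f w = Some v" using someI_ex[of "\<lambda>w. f w = Some v"] by (auto simp: ran_def)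
  next
    assume w: "f w = Some v"
    have "f (SOME w. f w = Some v) = Some v" using w by (rule someI)
    then have "(SOME w. f w = Some v) = w" using inj_onD[OF inj, of _ w] w by auto
    then show "g v = Some w" using ranI[of f, OF w] unfolding g_def by simp
  qed
  have domg: "dom g = ran f" unfolding g_def by (auto split: if_splits)
  have hg: "hom_between A B B g" unfolding hom_between_def domg
  proof (intro conjI allI impI)
    show "ran f \<subseteq> words A B" using hom_right_ideal(2)[OF f] unfolding right_ideal_def by simp
    show "ran g \<subseteq> words A B" using hom_dom[OF f] g by (auto simp: ran_def)
    obtain F where "finite F" "ran f = gen A F" using hom_ran_fg[OF f] .
    then show "\<exists>F. finite F \<and> ran f = gen A F" by blast
    show "g (w @ x) = Some (u @ x)" if "g w = Some u" "x \<in> lists A" for w x u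
      using hom_append[OF f, of u w x] that unfolding g by simp
  qed
  have "sim A B (g \<circ>\<^sub>m f) (id_on A B)" unfolding sim_def
  proof
    fix w assume w: "w \<in> words A B"
    obtain x where x: "x \<in> lists A" "w @ x \<in> dom f" using bspec[OF d(1) w] by blast
    then obtain u where u: "f (w @ x) = Some u" by auto
    have "(g \<circ>\<^sub>m f) (w @ x @ y) = id_on A B (w @ x @ y)" if y: "y \<in> lists A" for y
    proof -
      have "f (w @ x @ y) = Some (u @ y)" using hom_append[OF f u y] by simp
      then show ?thesis using g[of "u @ y" "w @ x @ y"] w x y by (simp add: id_on_def words_append)
    qed
    then show "\<exists>x\<in>lists A. \<forall>y\<in>lists A. (g \<circ>\<^sub>m f) (w @ x @ y) = id_on A B (w @ x @ y)" using x(1) by auto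
  qed
  moreover have "sim A B (f \<circ>\<^sub>m g) (id_on A B)" unfolding sim_def
  proof
    fix w assume w: "w \<in> words A B"
    obtain x where x: "x \<in> lists A" "w @ x \<in> dom g" using bspec[OF d(2) w] unfolding domg by blast
    then obtain u where u: "g (w @ x) = Some u" by auto
    have "(f \<circ>\<^sub>m g) (w @ x @ y) = id_on A B (w @ x @ y)" if y: "y \<in> lists A" for y
    proof -
      have "g (w @ x @ y) = Some (u @ y)" using hom_append[OF hg u y] by simp
      then show ?thesis using g[of "w @ x @ y" "u @ y"] w x y by (simp add: id_on_def words_append)
    qed
    then show "\<exists>x\<in>lists A. \<forall>y\<in>lists A. (f \<circ>\<^sub>m g) (w @ x @ y) = id_on A B (w @ x @ y)" using x(1) by auto
  qed
  ultimately show "hom_between A B B f \<and> (\<exists>g. hom_between A B B g \<and>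
     sim A B (g \<circ>\<^sub>m f) (id_on A B) \<and> sim A B (f \<circ>\<^sub>m g) (id_on A B))" using f hg by blast
next
  assume "hom_between A B B f \<and> (\<exists>g. hom_between A B B g \<and>
     sim A B (g \<circ>\<^sub>m f) (id_on A B) \<and> sim A B (f \<circ>\<^sub>m g) (id_on A B))"
  then obtain g where f: "hom_between A B B f" and g: "hom_between A B B g"
    and gf: "sim A B (g \<circ>\<^sub>m f) (id_on A B)" and fg: "sim A B (f \<circ>\<^sub>m g) (id_on A B)" by auto
  have "inj_on f (dom f)"
  proof (rule inj_onI)
    fix v w assume v: "v \<in> dom f" and w: "w \<in> dom f" and eq: "f v = f w"
    obtain u where u: "f v = Some u" "f w = Some u" using domD[OF v] eq by auto
    obtain x where x: "x \<in> lists A" "\<forall>y\<in>lists A. (g \<circ>\<^sub>m f) (v @ x @ y) = Some (v @ x @ y)"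
      using sim_id_on[OF gf hom_dom[OF f u(1)]] .
    have "f (v @ x) = Some (u @ x)" "f (w @ x) = Some (u @ x)"
      using hom_append[OF f u(1) x(1)] hom_append[OF f u(2) x(1)] .
    then have "(g \<circ>\<^sub>m f) (w @ x) = Some (v @ x)" using bspec[OF x(2) lists.Nil] by simp
    then show "v = w" using sim_id_on_Some[OF gf hom_comp[OF f g]] by fastforce
  qed
  moreover have "essential A B (dom f)" unfolding essential_iff[OF hom_right_ideal(1)[OF f]]
  proof
    fix w assume w: "w \<in> words A B"
    obtain x where x: "x \<in> lists A" "\<forall>y\<in>lists A. (g \<circ>\<^sub>m f) (w @ x @ y) = Some (w @ x @ y)"
      using sim_id_on[OF gf w] .
    then have "w @ x \<in> dom f" using bspec[OF x(2) lists.Nil] by (auto simp: map_comp_Some_iff)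
    then show "\<exists>x\<in>lists A. w @ x \<in> dom f" using x(1) by blast
  qed
  moreover have "essential A B (ran f)" unfolding essential_iff[OF hom_right_ideal(2)[OF f]]
  proof
    fix w assume w: "w \<in> words A B"
    obtain x where x: "x \<in> lists A" "\<forall>y\<in>lists A. (f \<circ>\<^sub>m g) (w @ x @ y) = Some (w @ x @ y)"
      using sim_id_on[OF fg w] .
    then have "w @ x \<in> ran f" using bspec[OF x(2) lists.Nil] by (auto simp: map_comp_Some_iff ran_def)
    then show "\<exists>x\<in>lists A. w @ x \<in> ran f" using x(1) by blast
  qed
  ultimately show "ri_iso A B f" unfolding ri_iso_def ri_hom_iff using f by simp
qed


section \<open>Green's relation D\<close>

text \<open>The main tool of the equational part: a split pair disappears from the inside of a
  composite.\<close>

lemma sim_mid_cancel: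
  assumes "hom_between A X B f" "sim A B (\<beta> \<circ>\<^sub>m \<beta>') (id_on A B)"
  shows "sim A X ((g \<circ>\<^sub>m \<beta>) \<circ>\<^sub>m (\<beta>' \<circ>\<^sub>m f)) (g \<circ>\<^sub>m f)"
  using sim_comp_right[OF sim_comp_left[OF assms], of g]
  unfolding id_on_comp[OF assms(1)] map_comp_assoc .

lemma sim_cancel_left:
  assumes \<alpha>: "sim A B (\<alpha>' \<circ>\<^sub>m \<alpha>) (id_on A B)"
    and f: "hom_between A X B f" and g: "hom_between A X B g"
    and "sim A X (\<alpha> \<circ>\<^sub>m f) (\<alpha> \<circ>\<^sub>m g)"
  shows "sim A X f g"
proof -
  have "sim A X (\<alpha>' \<circ>\<^sub>m (\<alpha> \<circ>\<^sub>m f)) f" "sim A X (\<alpha>' \<circ>\<^sub>m (\<alpha> \<circ>\<^sub>m g)) g"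
    using sim_comp_left[OF f \<alpha>] sim_comp_left[OF g \<alpha>]
    unfolding id_on_comp[OF f] id_on_comp[OF g] map_comp_assoc .
  then show ?thesis using sim_comp_right[OF assms(4), of \<alpha>'] sim_sym sim_trans by metis
qed

lemma sim_cancel_right:
  assumes \<beta>': "hom_between A B X \<beta>'" and \<beta>: "sim A B (\<beta> \<circ>\<^sub>m \<beta>') (id_on A B)"
    and f: "hom_between A B Y f" and g: "hom_between A B Y g"
    and "sim A X (f \<circ>\<^sub>m \<beta>) (g \<circ>\<^sub>m \<beta>)"
  shows "sim A B f g"
proof -
  have "sim A B ((f \<circ>\<^sub>m \<beta>) \<circ>\<^sub>m \<beta>') f" "sim A B ((g \<circ>\<^sub>m \<beta>) \<circ>\<^sub>m \<beta>') g"
    using sim_comp_right[OF \<beta>, of f] sim_comp_right[OF \<beta>, of g]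
    unfolding comp_id_on[OF f] comp_id_on[OF g] map_comp_assoc .
  then show ?thesis using sim_comp_left[OF \<beta>' assms(5)] sim_sym sim_trans by metis
qed

text \<open>An image factorisation of u through the object B: \<alpha> is a split monomorphism with
  retraction \<alpha>', and \<beta> a split epimorphism with section \<beta>'.\<close>

definition splitting :: "'a set \<Rightarrow> 'a set \<Rightarrow> 'a set \<Rightarrow> 'a pfun \<Rightarrow> 'a pfun \<Rightarrow> 'a pfun \<Rightarrow> 'a pfun \<Rightarrow> 'a pfun \<Rightarrow> bool" where
  "splitting A B C u \<alpha> \<alpha>' \<beta> \<beta>' \<longleftrightarrow>
     hom_between A B C \<alpha> \<and> hom_between A C B \<alpha>' \<and> hom_between A C B \<beta> \<and> hom_between A B C \<beta>' \<and>
     sim A B (\<alpha>' \<circ>\<^sub>m \<alpha>) (id_on A B) \<and> sim A B (\<beta> \<circ>\<^sub>m \<beta>') (id_on A B) \<and> sim A C (\<alpha> \<circ>\<^sub>m \<beta>) u"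

lemma splittingD:
  assumes "splitting A B C u \<alpha> \<alpha>' \<beta> \<beta>'"
  shows "hom_between A B C \<alpha>" "hom_between A C B \<alpha>'" "hom_between A C B \<beta>" "hom_between A B C \<beta>'"
    "sim A B (\<alpha>' \<circ>\<^sub>m \<alpha>) (id_on A B)" "sim A B (\<beta> \<circ>\<^sub>m \<beta>') (id_on A B)" "sim A C (\<alpha> \<circ>\<^sub>m \<beta>) u"
  using assms unfolding splitting_def by simp_all

section \<open>Products in the monoid as compositions modulo \<open>sim\<close>\<close>

lemma TH_carrier: "f \<in> carrier (TH_monoid A C) \<longleftrightarrow> hom_between A C C f \<and> max_ext A C f = f"
  unfolding TH_monoid_def ri_hom_iff by simp

lemma TH_mult: "g \<otimes>\<^bsub>TH_monoid A C\<^esub> f = max_ext A C (g \<circ>\<^sub>m f)"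
  unfolding TH_monoid_def by simp

lemma max_ext_in_carrier: "hom_between A C C f \<Longrightarrow> max_ext A C f \<in> carrier (TH_monoid A C)"
  by (simp add: TH_carrier hom_max_ext max_ext_idem)

lemma TH_eq_mult_iff:
  assumes "u \<in> carrier (TH_monoid A C)" "hom_between A C C s" "hom_between A C C x"
  shows "u = s \<otimes>\<^bsub>TH_monoid A C\<^esub> x \<longleftrightarrow> sim A C u (s \<circ>\<^sub>m x)"
proof -
  have u: "hom_between A C C u" "max_ext A C u = u" using assms(1) unfolding TH_carrier by simp_all
  show ?thesis unfolding TH_mult using max_ext_eq_iff[OF u(1) hom_comp[OF assms(3,2)]] u(2) by simp
qed

text \<open>For Green's relations: the cofactor x, assembled from a splitting, need not be maximal
  and is replaced by its normal form, while the other factor is a given element s' known only up to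
  \<open>sim\<close>. The primed variant is the mirror image.\<close>

lemma TH_eq_max_ext_mult:
  assumes "u \<in> carrier (TH_monoid A C)" "hom_between A C C s" "hom_between A C C x"
    and "hom_between A C C s'" "sim A C s' s" "sim A C u (s \<circ>\<^sub>m x)"
  shows "u = s' \<otimes>\<^bsub>TH_monoid A C\<^esub> max_ext A C x"
proof -
  have "sim A C (s \<circ>\<^sub>m x) (s' \<circ>\<^sub>m max_ext A C x)"
    using assms sim_comp sim_max_ext sim_sym by metis
  then show ?thesis
    using TH_eq_mult_iff[OF assms(1,4) hom_max_ext[OF assms(3)]] sim_trans[OF assms(6)] by simp
qed

lemma TH_eq_max_ext_mult':
  assumes "u \<in> carrier (TH_monoid A C)" "hom_between A C C s" "hom_between A C C x"
    and "hom_between A C C x'" "sim A C x' x" "sim A C u (s \<circ>\<^sub>m x)"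
  shows "u = max_ext A C s \<otimes>\<^bsub>TH_monoid A C\<^esub> x'"
proof -
  have "sim A C (s \<circ>\<^sub>m x) (max_ext A C s \<circ>\<^sub>m x')"
    using assms sim_comp sim_max_ext sim_sym by metis
  then show ?thesis
    using TH_eq_mult_iff[OF assms(1) hom_max_ext[OF assms(2)] assms(4)] sim_trans[OF assms(6)] by simp
qed

text \<open>The element linking u and v is \<alpha>\<delta>. It shares \<alpha> with u =
  \<alpha>\<beta>, which gives the R relation, and \<delta> with v = \<gamma>\<delta>, which gives
  the L relation.\<close>

lemma splitting_imp_D:
  assumes u: "u \<in> carrier (TH_monoid A C)" and v: "v \<in> carrier (TH_monoid A C)"
    and "splitting A B C u \<alpha> \<alpha>' \<beta> \<beta>'" "splitting A B C v \<gamma> \<gamma>' \<delta> \<delta>'"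
  shows "eq_D (TH_monoid A C) u v"
proof -
  note s = splittingD[OF assms(3)] and t = splittingD[OF assms(4)]
  have hu: "hom_between A C C u" and hv: "hom_between A C C v" using u v unfolding TH_carrier by simp_all
  define m where "m = max_ext A C (\<alpha> \<circ>\<^sub>m \<delta>)"
  have \<alpha>\<delta>: "hom_between A C C (\<alpha> \<circ>\<^sub>m \<delta>)" using hom_comp[OF t(3) s(1)] .
  have mc: "m \<in> carrier (TH_monoid A C)" unfolding m_def by (rule max_ext_in_carrier[OF \<alpha>\<delta>])
  have hm: "hom_between A C C m" and sm: "sim A C m (\<alpha> \<circ>\<^sub>m \<delta>)"
    unfolding m_def using hom_max_ext[OF \<alpha>\<delta>] sim_sym[OF sim_max_ext[OF \<alpha>\<delta>]] by simp_all
  have "u = m \<otimes>\<^bsub>TH_monoid A C\<^esub> max_ext A C (\<delta>' \<circ>\<^sub>m \<beta>)"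
    using sim_trans[OF sim_sym[OF s(7)] sim_sym[OF sim_mid_cancel[OF s(3) t(6), of \<alpha>]]]
    by (intro TH_eq_max_ext_mult[OF u \<alpha>\<delta> hom_comp[OF s(3) t(4)] hm sm])
  moreover have "m = u \<otimes>\<^bsub>TH_monoid A C\<^esub> max_ext A C (\<beta>' \<circ>\<^sub>m \<delta>)"
    using sim_trans[OF sm sim_sym[OF sim_mid_cancel[OF t(3) s(6), of \<alpha>]]]
    by (intro TH_eq_max_ext_mult[OF mc hom_comp[OF s(3,1)] hom_comp[OF t(3) s(4)] hu sim_sym[OF s(7)]])
  moreover have "m = max_ext A C (\<alpha> \<circ>\<^sub>m \<gamma>') \<otimes>\<^bsub>TH_monoid A C\<^esub> v"
    using sim_trans[OF sm sim_sym[OF sim_mid_cancel[OF t(3) t(5), of \<alpha>]]]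
    by (intro TH_eq_max_ext_mult'[OF mc hom_comp[OF t(2) s(1)] hom_comp[OF t(3,1)] hv sim_sym[OF t(7)]])
  moreover have "v = max_ext A C (\<gamma> \<circ>\<^sub>m \<alpha>') \<otimes>\<^bsub>TH_monoid A C\<^esub> m"
    using sim_trans[OF sim_sym[OF t(7)] sim_sym[OF sim_mid_cancel[OF t(3) s(5), of \<gamma>]]]
    by (intro TH_eq_max_ext_mult'[OF v hom_comp[OF s(2) t(1)] \<alpha>\<delta> hm sm])
  moreover have "max_ext A C (\<delta>' \<circ>\<^sub>m \<beta>) \<in> carrier (TH_monoid A C)"
    "max_ext A C (\<beta>' \<circ>\<^sub>m \<delta>) \<in> carrier (TH_monoid A C)"
    "max_ext A C (\<alpha> \<circ>\<^sub>m \<gamma>') \<in> carrier (TH_monoid A C)"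
    "max_ext A C (\<gamma> \<circ>\<^sub>m \<alpha>') \<in> carrier (TH_monoid A C)"
    by (rule max_ext_in_carrier, rule hom_comp[OF s(3) t(4)],
        rule max_ext_in_carrier, rule hom_comp[OF t(3) s(4)],
        rule max_ext_in_carrier, rule hom_comp[OF t(2) s(1)],
        rule max_ext_in_carrier, rule hom_comp[OF s(2) t(1)])
  ultimately have "eq_R (TH_monoid A C) u m" "eq_L (TH_monoid A C) m v"
    unfolding eq_R_def eq_L_def le_R_def le_L_def by blast+
  then show ?thesis unfolding eq_D_def using mc by auto
qed

lemma sim_split_left:
  assumes "sim A B (\<alpha>' \<circ>\<^sub>m \<alpha>) (id_on A B)" "hom_between A X B t" "sim A X s (\<alpha> \<circ>\<^sub>m t)"
  shows "sim A X (\<alpha> \<circ>\<^sub>m (\<alpha>' \<circ>\<^sub>m s)) s"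
proof -
  have "sim A X (\<alpha> \<circ>\<^sub>m (\<alpha>' \<circ>\<^sub>m s)) (\<alpha> \<circ>\<^sub>m (\<alpha>' \<circ>\<^sub>m (\<alpha> \<circ>\<^sub>m t)))"
    by (intro sim_comp_right assms(3))
  moreover have "sim A X (\<alpha> \<circ>\<^sub>m (\<alpha>' \<circ>\<^sub>m (\<alpha> \<circ>\<^sub>m t))) (\<alpha> \<circ>\<^sub>m t)"
    using sim_mid_cancel[OF assms(2,1), of \<alpha>] unfolding map_comp_assoc .
  ultimately show ?thesis using sim_trans sim_sym[OF assms(3)] by blast
qed

lemma sim_split_right:
  assumes "sim A B (\<beta> \<circ>\<^sub>m \<beta>') (id_on A B)" "hom_between A X B \<beta>" "hom_between A B X \<beta>'"
    "sim A X s (t \<circ>\<^sub>m \<beta>)"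
  shows "sim A X (s \<circ>\<^sub>m (\<beta>' \<circ>\<^sub>m \<beta>)) s"
proof -
  have "sim A X (s \<circ>\<^sub>m (\<beta>' \<circ>\<^sub>m \<beta>)) ((t \<circ>\<^sub>m \<beta>) \<circ>\<^sub>m (\<beta>' \<circ>\<^sub>m \<beta>))"
    by (rule sim_comp_left[OF hom_comp[OF assms(2,3)] assms(4)])
  moreover have "sim A X ((t \<circ>\<^sub>m \<beta>) \<circ>\<^sub>m (\<beta>' \<circ>\<^sub>m \<beta>)) (t \<circ>\<^sub>m \<beta>)"
    by (rule sim_mid_cancel[OF assms(2,1)])
  ultimately show ?thesis using sim_trans sim_sym[OF assms(4)] by blast
qed

lemma sim_inverse_unique:
  assumes c: "hom_between A X Y c" and d: "hom_between A Y X d" and d': "hom_between A Y X d'"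
    and cd: "sim A Y (c \<circ>\<^sub>m d) (id_on A Y)" and dc: "sim A X (d' \<circ>\<^sub>m c) (id_on A X)"
  shows "sim A X (d \<circ>\<^sub>m c) (id_on A X)"
proof -
  have "sim A Y ((d' \<circ>\<^sub>m c) \<circ>\<^sub>m d) d"
    using sim_comp_left[OF d dc] unfolding id_on_comp[OF d] .
  moreover have "sim A Y ((d' \<circ>\<^sub>m c) \<circ>\<^sub>m d) d'"
    using sim_comp_right[OF cd, of d'] unfolding comp_id_on[OF d'] map_comp_assoc .
  ultimately have "sim A Y d d'" using sim_sym sim_trans by blast
  then show ?thesis using sim_comp_left[OF c] sim_trans[OF _ dc] by blast
qed

text \<open>The linking element m factors through \<alpha> on the left and through \<delta> on the
  right, hence m = \<alpha>d\<delta> for a map d between the two letter sets. Recovering u from m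
  gives d a right inverse, recovering v a left inverse.\<close>

lemma D_imp_iso:
  assumes u: "u \<in> carrier (TH_monoid A C)" and v: "v \<in> carrier (TH_monoid A C)"
    and "splitting A B C u \<alpha> \<alpha>' \<beta> \<beta>'" "splitting A B' C v \<gamma> \<gamma>' \<delta> \<delta>'"
    and D: "eq_D (TH_monoid A C) u v"
  obtains c d where "hom_between A B B' c" "hom_between A B' B d"
    "sim A B (d \<circ>\<^sub>m c) (id_on A B)" "sim A B' (c \<circ>\<^sub>m d) (id_on A B')"
proof -
  note s = splittingD[OF assms(3)] and t = splittingD[OF assms(4)]
  obtain m x y z w where m: "m \<in> carrier (TH_monoid A C)"
    and xyzw: "x \<in> carrier (TH_monoid A C)" "y \<in> carrier (TH_monoid A C)"
      "z \<in> carrier (TH_monoid A C)" "w \<in> carrier (TH_monoid A C)"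
    and eqs: "m = u \<otimes>\<^bsub>TH_monoid A C\<^esub> x" "u = m \<otimes>\<^bsub>TH_monoid A C\<^esub> y"
      "m = z \<otimes>\<^bsub>TH_monoid A C\<^esub> v" "v = w \<otimes>\<^bsub>TH_monoid A C\<^esub> m"
    using D unfolding eq_D_def eq_R_def eq_L_def le_R_def le_L_def by metis
  have h: "hom_between A C C u" "hom_between A C C v" "hom_between A C C m"
    "hom_between A C C x" "hom_between A C C y" "hom_between A C C z" "hom_between A C C w"
    using u v m xyzw unfolding TH_carrier by simp_all
  have e: "sim A C m (u \<circ>\<^sub>m x)" "sim A C u (m \<circ>\<^sub>m y)" "sim A C m (z \<circ>\<^sub>m v)" "sim A C v (w \<circ>\<^sub>m m)"
    using TH_eq_mult_iff[OF m h(1,4)] TH_eq_mult_iff[OF u h(3,5)]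
      TH_eq_mult_iff[OF m h(6,2)] TH_eq_mult_iff[OF v h(7,3)] eqs by blast+
  have "sim A C m (\<alpha> \<circ>\<^sub>m (\<beta> \<circ>\<^sub>m x))"
    using sim_trans[OF e(1) sim_comp_left[OF h(4) sim_sym[OF s(7)]]] unfolding map_comp_assoc .
  then have l: "sim A C (\<alpha> \<circ>\<^sub>m (\<alpha>' \<circ>\<^sub>m m)) m"
    by (rule sim_split_left[OF s(5) hom_comp[OF h(4) s(3)]])
  have "sim A C m ((z \<circ>\<^sub>m \<gamma>) \<circ>\<^sub>m \<delta>)"
    using sim_trans[OF e(3) sim_comp_right[OF sim_sym[OF t(7)]]] unfolding map_comp_assoc .
  then have r: "sim A C (m \<circ>\<^sub>m (\<delta>' \<circ>\<^sub>m \<delta>)) m"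
    by (rule sim_split_right[OF t(6,3,4)])
  \<comment> \<open>Forced by m = \<alpha>d\<delta>, solved with the retraction \<alpha>' and the
    section \<delta>'.\<close>
  define d where "d = \<alpha>' \<circ>\<^sub>m (m \<circ>\<^sub>m \<delta>')"
  have hd: "hom_between A B' B d" unfolding d_def using hom_comp[OF hom_comp[OF t(4) h(3)] s(2)] .
  have "sim A C ((\<alpha> \<circ>\<^sub>m (\<alpha>' \<circ>\<^sub>m m)) \<circ>\<^sub>m (\<delta>' \<circ>\<^sub>m \<delta>)) (m \<circ>\<^sub>m (\<delta>' \<circ>\<^sub>m \<delta>))"
    by (rule sim_comp_left[OF hom_comp[OF t(3,4)] l])
  then have mid: "sim A C ((\<alpha> \<circ>\<^sub>m d) \<circ>\<^sub>m \<delta>) m"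
    using sim_trans[OF _ r] unfolding d_def map_comp_assoc by blast
  have "sim A C (\<alpha> \<circ>\<^sub>m \<beta>) (((\<alpha> \<circ>\<^sub>m d) \<circ>\<^sub>m \<delta>) \<circ>\<^sub>m y)"
    using sim_trans[OF s(7) sim_trans[OF e(2) sim_comp_left[OF h(5) sim_sym[OF mid]]]] .
  then have "sim A C (\<alpha> \<circ>\<^sub>m \<beta>) (\<alpha> \<circ>\<^sub>m (d \<circ>\<^sub>m (\<delta> \<circ>\<^sub>m y)))" unfolding map_comp_assoc .
  \<comment> \<open>Cancelling \<alpha> and precomposing \<beta>' exhibits \<delta>y\<beta>' as a
    right inverse of d.\<close>
  then have "sim A C \<beta> (d \<circ>\<^sub>m (\<delta> \<circ>\<^sub>m y))"
    by (rule sim_cancel_left[OF s(5,3) hom_comp[OF hom_comp[OF h(5) t(3)] hd]])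
  then have "sim A B (\<beta> \<circ>\<^sub>m \<beta>') ((d \<circ>\<^sub>m (\<delta> \<circ>\<^sub>m y)) \<circ>\<^sub>m \<beta>')" by (rule sim_comp_left[OF s(4)])
  then have dc: "sim A B (d \<circ>\<^sub>m (\<delta> \<circ>\<^sub>m (y \<circ>\<^sub>m \<beta>'))) (id_on A B)"
    using sim_trans[OF sim_sym s(6)] unfolding map_comp_assoc by blast
  have "sim A C (\<gamma> \<circ>\<^sub>m \<delta>) (w \<circ>\<^sub>m ((\<alpha> \<circ>\<^sub>m d) \<circ>\<^sub>m \<delta>))"
    using sim_trans[OF t(7) sim_trans[OF e(4) sim_comp_right[OF sim_sym[OF mid]]]] .
  then have "sim A C (\<gamma> \<circ>\<^sub>m \<delta>) ((w \<circ>\<^sub>m (\<alpha> \<circ>\<^sub>m d)) \<circ>\<^sub>m \<delta>)" unfolding map_comp_assoc .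
  \<comment> \<open>Dually, cancelling \<delta> and applying \<gamma>' exhibits \<gamma>'w\<alpha>
    as a left inverse of d.\<close>
  then have "sim A B' \<gamma> (w \<circ>\<^sub>m (\<alpha> \<circ>\<^sub>m d))"
    by (rule sim_cancel_right[OF t(4,6,1) hom_comp[OF hom_comp[OF hd s(1)] h(7)]])
  then have "sim A B' (\<gamma>' \<circ>\<^sub>m \<gamma>) (\<gamma>' \<circ>\<^sub>m (w \<circ>\<^sub>m (\<alpha> \<circ>\<^sub>m d)))" by (rule sim_comp_right)
  then have cd: "sim A B' ((\<gamma>' \<circ>\<^sub>m (w \<circ>\<^sub>m \<alpha>)) \<circ>\<^sub>m d) (id_on A B')"
    using sim_trans[OF sim_sym t(5)] unfolding map_comp_assoc by blast
  have hc: "hom_between A B B' (\<delta> \<circ>\<^sub>m (y \<circ>\<^sub>m \<beta>'))" "hom_between A B B' (\<gamma>' \<circ>\<^sub>m (w \<circ>\<^sub>m \<alpha>))"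
    using hom_comp[OF hom_comp[OF s(4) h(5)] t(3)] hom_comp[OF hom_comp[OF s(1) h(7)] t(2)] .
  show thesis using that[OF hc(1) hd dc] sim_inverse_unique[OF hd hc dc cd] by simp
qed

lemma iso_nonempty:
  assumes "B \<noteq> {}" "hom_between A B B' c" "hom_between A B' B d" "sim A B (d \<circ>\<^sub>m c) (id_on A B)"
  shows "B' \<noteq> {}"
proof -
  obtain b where "b \<in> B" using assms(1) by auto
  then have "[b] \<in> words A B" unfolding words_def by simp
  then obtain x where x: "x \<in> lists A" "\<forall>y\<in>lists A. (d \<circ>\<^sub>m c) ([b] @ x @ y) = Some ([b] @ x @ y)"
    by (rule sim_id_on[OF assms(4)])
  then obtain u where "c ([b] @ x @ []) = Some u" using bspec[OF x(2) lists.Nil] by (auto simp: map_comp_Some_iff)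
  then have "u \<in> words A B'" using hom_ran[OF assms(2)] by simp
  then show ?thesis unfolding words_def by auto
qed

text \<open>Without letters there are no words, so the identities on the middle object hold
  vacuously. This brings the zero under \<open>D_imp_iso\<close>, and \<open>iso_nonempty\<close>
  then keeps it apart from the indexed classes.\<close>

lemma splitting_empty: "splitting A {} C Map.empty Map.empty Map.empty Map.empty Map.empty"
proof -
  have "hom_between A B D Map.empty" for B D
    unfolding hom_between_def gen_def by auto
  then show ?thesis unfolding splitting_def by (simp add: sim_refl) (simp add: sim_def words_def)
qed

lemma splitting_imC:
  assumes A: "finite A" "A \<noteq> {}" and B: "finite B" "B \<noteq> {}"
    and u: "u \<in> carrier (TH_monoid A C)" "u \<noteq> Map.empty" "[card (imC A C u) = card B] (mod (card A - 1))"
  obtains \<alpha> \<alpha>' \<beta> \<beta>' where "splitting A B C u \<alpha> \<alpha>' \<beta> \<beta>'"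
proof -
  have "hom_between A C C u" using u(1) unfolding TH_carrier by simp
  from hom_factor[OF A B this u(2,3)] show thesis using that unfolding splitting_def by metis
qed

text \<open>Representatives run from 1 to k rather than from 0 to k - 1, because they become sizes
  of nonempty letter sets.\<close>

lemma obtain_residue:
  fixes m k :: nat assumes "k \<ge> 1" obtains r where "1 \<le> r" "r \<le> k" "[m = r] (mod k)"
proof (cases "m mod k = 0")
  case True
  then show thesis using that[of k] assms by (simp add: cong_def)
next
  case False
  then have "1 \<le> m mod k" "m mod k \<le> k" using assms by (simp_all add: Suc_le_eq)
  moreover have "[m = m mod k] (mod k)" by (simp add: cong_def)
  ultimately show thesis by (rule that)
qed

lemma D_index_class_in_D_classes:
  fixes A B :: "'a set"
  assumes A: "finite A" "2 \<le> card A" and B: "finite B" "B \<noteq> {}" "card B \<le> card A - 1"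
  shows "D_index_class A b (card B) \<in> D_classes (TH_monoid A {b})"
proof -
  have An: "A \<noteq> {}" using A by auto
  \<comment> \<open>Words of length one over the letter b give a single code word, so the code is
    taken from the words b a of length two; A has enough letters because
    \<open>card B \<le> card A - 1\<close>.\<close>
  obtain A' where A': "A' \<subseteq> A" "card A' = card B"
    using obtain_subset_with_card_n[of "card B" A] A B by (metis diff_le_self le_trans)
  define Q where "Q = (\<lambda>a. [b, a]) ` A'"
  have Q: "finite Q" "card Q = card B" "prefix_code A {b} Q"
  proof -
    show "finite Q" unfolding Q_def using A' A finite_subset by blast
    show "card Q = card B" unfolding Q_def A'(2)[symmetric] by (intro card_image) (simp add: inj_on_def)
    show "prefix_code A {b} Q"
      unfolding prefix_code_def Q_def words_def using A' by (auto simp: strict_prefix_def)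
  qed
  have Qn: "Q \<noteq> {}" using Q B by auto
  have "[card Q = card B] (mod (card A - 1))" using Q by simp
  then obtain \<alpha> \<alpha>' where \<alpha>: "hom_between A B {b} \<alpha>" "hom_between A {b} B \<alpha>'"
    "sim A B (\<alpha>' \<circ>\<^sub>m \<alpha>) (id_on A B)"
    using code_retract[OF A(1) An B(1,2) Q(1,3) Qn] by metis
  \<comment> \<open>The representative is the idempotent \<alpha>\<alpha>', whose splitting through
    B is immediate.\<close>
  define u where "u = max_ext A {b} (\<alpha> \<circ>\<^sub>m \<alpha>')"
  have \<alpha>\<alpha>: "hom_between A {b} {b} (\<alpha> \<circ>\<^sub>m \<alpha>')" using hom_comp[OF \<alpha>(2,1)] .
  have u: "u \<in> carrier (TH_monoid A {b})" unfolding u_def by (rule max_ext_in_carrier[OF \<alpha>\<alpha>])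
  have split: "splitting A B {b} u \<alpha> \<alpha>' \<alpha>' \<alpha>"
    unfolding splitting_def u_def using \<alpha> sim_max_ext[OF \<alpha>\<alpha>] by simp
  have "D_index_class A b (card B) = {v \<in> carrier (TH_monoid A {b}). eq_D (TH_monoid A {b}) u v}"
  proof (intro equalityI subsetI)
    fix v assume "v \<in> D_index_class A b (card B)"
    then have v: "v \<in> carrier (TH_monoid A {b})" "v \<noteq> Map.empty" "[card (imC A {b} v) = card B] (mod (card A - 1))"
      unfolding D_index_class_def by simp_all
    obtain \<gamma> \<gamma>' \<delta> \<delta>' where "splitting A B {b} v \<gamma> \<gamma>' \<delta> \<delta>'" using splitting_imC[OF A(1) An B(1,2) v] .
    then show "v \<in> {v \<in> carrier (TH_monoid A {b}). eq_D (TH_monoid A {b}) u v}"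
      using splitting_imp_D[OF u v(1) split] v by simp
  next
    fix v assume "v \<in> {v \<in> carrier (TH_monoid A {b}). eq_D (TH_monoid A {b}) u v}"
    then have v: "v \<in> carrier (TH_monoid A {b})" and D: "eq_D (TH_monoid A {b}) u v" by simp_all
    have vn: "v \<noteq> Map.empty"
    proof
      assume "v = Map.empty"
      then have sp: "splitting A {} {b} v Map.empty Map.empty Map.empty Map.empty"
        using splitting_empty by simp
      show False
      proof (rule D_imp_iso[OF u v split sp D])
        fix c d assume "hom_between A B {} c" "hom_between A {} B d" "sim A B (d \<circ>\<^sub>m c) (id_on A B)"
        from iso_nonempty[OF B(2) this] show False by simp
      qed
    qed
    have k1: "1 \<le> card A - 1" using A by simp
    \<comment> \<open>The code size of v selects a second letter set E, through which v splits. Only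
      the number of its elements matters, and A is large enough to supply them;
      \<open>iso_card\<close> for B and E then fixes the residue.\<close>
    obtain r where r: "1 \<le> r" "r \<le> card A - 1" "[card (imC A {b} v) = r] (mod (card A - 1))"
      using obtain_residue[OF k1] .
    have "r \<le> card A" using r by simp
    then obtain E where E: "E \<subseteq> A" "card E = r" "finite E" by (rule obtain_subset_with_card_n)
    have E': "finite E" "E \<noteq> {}" using E r by auto
    have "[card (imC A {b} v) = card E] (mod (card A - 1))" using r E by simp
    then obtain \<gamma> \<gamma>' \<delta> \<delta>' where sp: "splitting A E {b} v \<gamma> \<gamma>' \<delta> \<delta>'"
      using splitting_imC[OF A(1) An E' v vn] by metis
    have "[card B = card E] (mod (card A - 1))"
      by (rule D_imp_iso[OF u v split sp D]) (rule iso_card[OF A(1) An B(1) E'(1)])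
    then have "[card (imC A {b} v) = card B] (mod (card A - 1))" using r E by (simp add: cong_def)
    then show "v \<in> D_index_class A b (card B)" unfolding D_index_class_def using v vn by simp
  qed
  then show ?thesis unfolding D_classes_def using u by blast
qed


section \<open>Maximal subgroups\<close>

lemma max_ext_id_on: "finite B \<Longrightarrow> max_ext A B (id_on A B) = id_on A B"
proof -
  assume "finite B"
  then have h: "hom_between A B B (id_on A B)" by (rule hom_id_on)
  have "max_map A B (id_on A B) w = id_on A B w" for w
  proof (cases "w \<in> words A B")
    case True
    then have "w \<in> dom (id_on A B)" unfolding id_on_def by auto
    then show ?thesis using hom_le_max_map[OF h] unfolding map_le_def by simp
  next
    case False
    then have "max_map A B (id_on A B) w = None" unfolding max_map_def by simp
    then show ?thesis using False unfolding id_on_def by simp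
  qed
  then show ?thesis using max_ext_eq_max_map[OF h] by auto
qed

section \<open>The group as the units modulo \<open>sim\<close>\<close>

lemma TH_group_carrier:
  "f \<in> carrier (TH_group A B) \<longleftrightarrow> ri_iso A B f \<and> max_ext A B f = f"
  unfolding TH_group_def by simp

lemma TH_group_mult: "g \<otimes>\<^bsub>TH_group A B\<^esub> f = max_ext A B (g \<circ>\<^sub>m f)"
  unfolding TH_group_def TH_monoid_def by simp

lemma TH_group_one: "\<one>\<^bsub>TH_group A B\<^esub> = id_on A B"
  unfolding TH_group_def TH_monoid_def id_on_def by simp

definition inverses :: "'a set \<Rightarrow> 'a set \<Rightarrow> 'a pfun \<Rightarrow> 'a pfun \<Rightarrow> bool" where
  "inverses A B f g \<longleftrightarrow> hom_between A B B f \<and> hom_between A B B g \<and>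
     sim A B (g \<circ>\<^sub>m f) (id_on A B) \<and> sim A B (f \<circ>\<^sub>m g) (id_on A B)"

lemma inverses_sym: "inverses A B f g \<Longrightarrow> inverses A B g f"
  unfolding inverses_def by simp

lemma inverses_sim:
  assumes "inverses A B f g" "hom_between A B B f'" "hom_between A B B g'" "sim A B f' f" "sim A B g' g"
  shows "inverses A B f' g'"
proof -
  have "sim A B (g' \<circ>\<^sub>m f') (g \<circ>\<^sub>m f)" "sim A B (f' \<circ>\<^sub>m g') (f \<circ>\<^sub>m g)"
    using sim_comp[OF assms(4,2,5)] sim_comp[OF assms(5,3,4)] .
  moreover have "sim A B (g \<circ>\<^sub>m f) (id_on A B)" "sim A B (f \<circ>\<^sub>m g) (id_on A B)"
    using assms(1) unfolding inverses_def by simp_all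
  ultimately show ?thesis using assms(2,3) sim_trans unfolding inverses_def by blast
qed

lemma inverses_max_ext:
  assumes "inverses A B f g" shows "inverses A B (max_ext A B f) (max_ext A B g)"
proof -
  have h: "hom_between A B B f" "hom_between A B B g" using assms unfolding inverses_def by simp_all
  show ?thesis
    by (rule inverses_sim[OF assms hom_max_ext[OF h(1)] hom_max_ext[OF h(2)]
        sim_sym[OF sim_max_ext[OF h(1)]] sim_sym[OF sim_max_ext[OF h(2)]]])
qed

lemma inverses_comp:
  assumes "inverses A B f f'" "inverses A B g g'"
  shows "inverses A B (g \<circ>\<^sub>m f) (f' \<circ>\<^sub>m g')"
proof -
  have h: "hom_between A B B f" "hom_between A B B f'" "hom_between A B B g" "hom_between A B B g'"
    and s: "sim A B (f' \<circ>\<^sub>m f) (id_on A B)" "sim A B (f \<circ>\<^sub>m f') (id_on A B)"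
      "sim A B (g' \<circ>\<^sub>m g) (id_on A B)" "sim A B (g \<circ>\<^sub>m g') (id_on A B)"
    using assms unfolding inverses_def by simp_all
  show ?thesis unfolding inverses_def
    using hom_comp[OF h(1,3)] hom_comp[OF h(4,2)]
      sim_trans[OF sim_mid_cancel[OF h(1) s(3)] s(1)] sim_trans[OF sim_mid_cancel[OF h(4) s(2)] s(4)]
    by simp
qed

lemma TH_group_carrier_iff:
  "f \<in> carrier (TH_group A B) \<longleftrightarrow> max_ext A B f = f \<and> (\<exists>g. inverses A B f g)"
  unfolding TH_group_carrier ri_iso_iff inverses_def by blast

lemma max_ext_in_TH_group: "inverses A B f g \<Longrightarrow> max_ext A B f \<in> carrier (TH_group A B)"
  unfolding TH_group_carrier_iff using inverses_max_ext
  by (metis inverses_def max_ext_idem)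

lemma hom_TH_group: "f \<in> carrier (TH_group A B) \<Longrightarrow> hom_between A B B f"
  unfolding TH_group_carrier ri_iso_def ri_hom_iff by simp

lemma group_TH_group:
  assumes B: "finite B" shows "group (TH_group A B)"
proof (rule groupI)
  fix x y assume x: "x \<in> carrier (TH_group A B)" and y: "y \<in> carrier (TH_group A B)"
  then obtain x' y' where "inverses A B x x'" "inverses A B y y'"
    unfolding TH_group_carrier_iff by auto
  then show "x \<otimes>\<^bsub>TH_group A B\<^esub> y \<in> carrier (TH_group A B)"
    unfolding TH_group_mult using max_ext_in_TH_group inverses_comp by blast
next
  have "inverses A B (id_on A B) (id_on A B)"
    unfolding inverses_def using hom_id_on[OF B, of A] id_on_comp[OF hom_id_on[OF B, of A]]
    by (simp add: sim_refl)
  from max_ext_in_TH_group[OF this] show "\<one>\<^bsub>TH_group A B\<^esub> \<in> carrier (TH_group A B)"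
    unfolding TH_group_one max_ext_id_on[OF B] .
next
  fix x y z assume xyz: "x \<in> carrier (TH_group A B)" "y \<in> carrier (TH_group A B)" "z \<in> carrier (TH_group A B)"
  note h = xyz[THEN hom_TH_group]
  have hxy: "hom_between A B B (x \<circ>\<^sub>m y)" and hyz: "hom_between A B B (y \<circ>\<^sub>m z)"
    using hom_comp[OF h(2,1)] hom_comp[OF h(3,2)] .
  have "sim A B (max_ext A B (x \<circ>\<^sub>m y) \<circ>\<^sub>m z) ((x \<circ>\<^sub>m y) \<circ>\<^sub>m z)"
    by (rule sim_comp_left[OF h(3) sim_sym[OF sim_max_ext[OF hxy]]])
  moreover have "sim A B (x \<circ>\<^sub>m (y \<circ>\<^sub>m z)) (x \<circ>\<^sub>m max_ext A B (y \<circ>\<^sub>m z))"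
    by (rule sim_comp_right[OF sim_max_ext[OF hyz]])
  ultimately have "sim A B (max_ext A B (x \<circ>\<^sub>m y) \<circ>\<^sub>m z) (x \<circ>\<^sub>m max_ext A B (y \<circ>\<^sub>m z))"
    unfolding map_comp_assoc by (rule sim_trans)
  then show "x \<otimes>\<^bsub>TH_group A B\<^esub> y \<otimes>\<^bsub>TH_group A B\<^esub> z = x \<otimes>\<^bsub>TH_group A B\<^esub> (y \<otimes>\<^bsub>TH_group A B\<^esub> z)"
    unfolding TH_group_mult
    using max_ext_eq_iff[OF hom_comp[OF h(3) hom_max_ext[OF hxy]] hom_comp[OF hom_max_ext[OF hyz] h(1)]]
    by simp
next
  fix x assume x: "x \<in> carrier (TH_group A B)"
  then show "\<one>\<^bsub>TH_group A B\<^esub> \<otimes>\<^bsub>TH_group A B\<^esub> x = x"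
    unfolding TH_group_one TH_group_mult using id_on_comp[OF hom_TH_group[OF x]]
    by (simp add: TH_group_carrier)
  obtain y where y: "inverses A B x y" using x unfolding TH_group_carrier_iff by auto
  have hy: "hom_between A B B y" and s: "sim A B (y \<circ>\<^sub>m x) (id_on A B)"
    using y unfolding inverses_def by simp_all
  note hx = hom_TH_group[OF x]
  have "sim A B (max_ext A B y \<circ>\<^sub>m x) (id_on A B)"
    using sim_trans[OF sim_comp_left[OF hx sim_sym[OF sim_max_ext[OF hy]]] s] .
  then have "max_ext A B y \<otimes>\<^bsub>TH_group A B\<^esub> x = \<one>\<^bsub>TH_group A B\<^esub>"
    unfolding TH_group_mult TH_group_one
    using max_ext_eq_iff[OF hom_comp[OF hx hom_max_ext[OF hy]] hom_id_on[OF B]] max_ext_id_on[OF B] by metis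
  then show "\<exists>y\<in>carrier (TH_group A B). y \<otimes>\<^bsub>TH_group A B\<^esub> x = \<one>\<^bsub>TH_group A B\<^esub>"
    using max_ext_in_TH_group[OF inverses_sym[OF y]] by blast
qed

text \<open>From \<alpha>\<beta>\<alpha>\<beta> = \<alpha>\<beta> cancel the monomorphism \<alpha>
  on the left and the epimorphism \<beta> on the right.\<close>

lemma idempotent_splitting:
  assumes "splitting A B C e \<alpha> \<alpha>' \<beta> \<beta>'" and e: "hom_between A C C e" and B: "finite B"
    and ee: "sim A C (e \<circ>\<^sub>m e) e"
  shows "sim A B (\<beta> \<circ>\<^sub>m \<alpha>) (id_on A B)"
proof -
  note s = splittingD[OF assms(1)]
  have \<beta>\<alpha>: "hom_between A B B (\<beta> \<circ>\<^sub>m \<alpha>)" using hom_comp[OF s(1,3)] .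
  have "sim A C ((\<alpha> \<circ>\<^sub>m \<beta>) \<circ>\<^sub>m (\<alpha> \<circ>\<^sub>m \<beta>)) (e \<circ>\<^sub>m e)"
    by (rule sim_comp[OF s(7) hom_comp[OF s(3,1)] s(7)])
  then have "sim A C ((\<alpha> \<circ>\<^sub>m \<beta>) \<circ>\<^sub>m (\<alpha> \<circ>\<^sub>m \<beta>)) (\<alpha> \<circ>\<^sub>m \<beta>)"
    using sim_trans ee sim_sym[OF s(7)] by blast
  then have "sim A C (\<alpha> \<circ>\<^sub>m ((\<beta> \<circ>\<^sub>m \<alpha>) \<circ>\<^sub>m \<beta>)) (\<alpha> \<circ>\<^sub>m \<beta>)" unfolding map_comp_assoc .
  then have "sim A C ((\<beta> \<circ>\<^sub>m \<alpha>) \<circ>\<^sub>m \<beta>) \<beta>"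
    by (rule sim_cancel_left[OF s(5) hom_comp[OF s(3) \<beta>\<alpha>] s(3)])
  then have "sim A C ((\<beta> \<circ>\<^sub>m \<alpha>) \<circ>\<^sub>m \<beta>) (id_on A B \<circ>\<^sub>m \<beta>)" unfolding id_on_comp[OF s(3)] .
  then show ?thesis by (rule sim_cancel_right[OF s(4,6) \<beta>\<alpha> hom_id_on[OF B]])
qed

lemma sim_left_inverse:
  assumes "sim A B (\<beta> \<circ>\<^sub>m \<alpha>) (id_on A B)" "hom_between A X B f"
  shows "sim A X (\<beta> \<circ>\<^sub>m (\<alpha> \<circ>\<^sub>m f)) f"
  using sim_comp_left[OF assms(2,1)] unfolding id_on_comp[OF assms(2)] map_comp_assoc .

lemma maximal_subgroup_iso:
  assumes B: "finite B" and s: "splitting A B C e \<alpha> \<alpha>' \<beta> \<beta>'"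
    and max: "maximal_subgroup_at (TH_monoid A C) H e"
  shows "(TH_monoid A C)\<lparr>carrier := H, one := e\<rparr> \<cong> TH_group A B"
proof -
  let ?M = "TH_monoid A C" and ?G = "TH_group A B"
  interpret H: group "?M\<lparr>carrier := H, one := e\<rparr>"
    using max unfolding maximal_subgroup_at_def subgroup_at_def by simp
  have HM: "H \<subseteq> carrier ?M" using max unfolding maximal_subgroup_at_def subgroup_at_def by simp
  have eH: "e \<in> H" using H.one_closed by simp
  have hH: "hom_between A C C h" "max_ext A C h = h" if "h \<in> H" for h
    using HM that unfolding TH_carrier[symmetric] subset_iff by (auto simp: TH_carrier)
  have simH: "sim A C h (f \<circ>\<^sub>m g)" if "f \<in> H" "g \<in> H" "h = f \<otimes>\<^bsub>?M\<^esub> g" for f g h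
  proof -
    have "h \<in> H" using H.m_closed[of f g] that by simp
    then show ?thesis using that TH_eq_mult_iff[of h A C f g] hH HM by blast
  qed
  have eh: "sim A C h (e \<circ>\<^sub>m h)" "sim A C h (h \<circ>\<^sub>m e)" if "h \<in> H" for h
    using simH[OF eH that] simH[OF that eH] H.l_one[of h] H.r_one[of h] that by simp_all
  note d = splittingD[OF s]
  have \<beta>\<alpha>: "sim A B (\<beta> \<circ>\<^sub>m \<alpha>) (id_on A B)"
    by (rule idempotent_splitting[OF s hH(1)[OF eH] B sim_sym[OF eh(1)[OF eH]]])
  \<comment> \<open>The inverse direction is h \<mapsto> \<beta>h\<alpha>, since \<beta>\<alpha> = 1
    and \<alpha>\<beta> = e. In products the inner pair \<beta>\<alpha> cancels, which makes the map
    multiplicative.\<close>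
  define \<Phi> where "\<Phi> g = max_ext A C (\<alpha> \<circ>\<^sub>m (g \<circ>\<^sub>m \<beta>))" for g
  have hom\<Phi>: "hom_between A C C (\<alpha> \<circ>\<^sub>m (g \<circ>\<^sub>m \<beta>))" if "hom_between A B B g" for g
    using hom_comp[OF hom_comp[OF d(3) that] d(1)] .
  have \<Phi>M: "\<Phi> g \<in> carrier ?M" if "g \<in> carrier ?G" for g
    unfolding \<Phi>_def by (rule max_ext_in_carrier[OF hom\<Phi>[OF hom_TH_group[OF that]]])
  have \<Phi>mult: "\<Phi> (x \<otimes>\<^bsub>?G\<^esub> y) = \<Phi> x \<otimes>\<^bsub>?M\<^esub> \<Phi> y" if "x \<in> carrier ?G" "y \<in> carrier ?G" for x y
  proof -
    note hx = hom_TH_group[OF that(1)] and hy = hom_TH_group[OF that(2)]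
    have hxy: "hom_between A B B (x \<circ>\<^sub>m y)" using hom_comp[OF hy hx] .
    have "sim A C (\<alpha> \<circ>\<^sub>m (max_ext A B (x \<circ>\<^sub>m y) \<circ>\<^sub>m \<beta>)) (\<alpha> \<circ>\<^sub>m ((x \<circ>\<^sub>m y) \<circ>\<^sub>m \<beta>))"
      by (intro sim_comp_right sim_comp_left[OF d(3)] sim_sym[OF sim_max_ext[OF hxy]])
    also have "sim A C (\<alpha> \<circ>\<^sub>m ((x \<circ>\<^sub>m y) \<circ>\<^sub>m \<beta>)) ((\<alpha> \<circ>\<^sub>m (x \<circ>\<^sub>m \<beta>)) \<circ>\<^sub>m (\<alpha> \<circ>\<^sub>m (y \<circ>\<^sub>m \<beta>)))"
      using sim_sym[OF sim_mid_cancel[OF hom_comp[OF d(3) hy] \<beta>\<alpha>, of "\<alpha> \<circ>\<^sub>m x"]]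
      unfolding map_comp_assoc .
    also have "sim A C ((\<alpha> \<circ>\<^sub>m (x \<circ>\<^sub>m \<beta>)) \<circ>\<^sub>m (\<alpha> \<circ>\<^sub>m (y \<circ>\<^sub>m \<beta>))) (\<Phi> x \<circ>\<^sub>m \<Phi> y)"
      unfolding \<Phi>_def by (rule sim_comp[OF sim_max_ext[OF hom\<Phi>[OF hy]] hom\<Phi>[OF hy] sim_max_ext[OF hom\<Phi>[OF hx]]])
    finally have "sim A C (\<alpha> \<circ>\<^sub>m (max_ext A B (x \<circ>\<^sub>m y) \<circ>\<^sub>m \<beta>)) (\<Phi> x \<circ>\<^sub>m \<Phi> y)" .
    moreover have "hom_between A C C (\<Phi> x \<circ>\<^sub>m \<Phi> y)"
      using \<Phi>M that hom_comp unfolding TH_carrier by blast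
    ultimately show ?thesis
      using max_ext_eq_iff[OF hom\<Phi>[OF hom_max_ext[OF hxy]]]
      unfolding TH_mult TH_group_mult \<Phi>_def[of "max_ext A B (x \<circ>\<^sub>m y)"] by blast
  qed
  have inj: "inj_on \<Phi> (carrier ?G)"
  proof (rule inj_onI)
    fix x y assume x: "x \<in> carrier ?G" and y: "y \<in> carrier ?G" and "\<Phi> x = \<Phi> y"
    note hx = hom_TH_group[OF x] and hy = hom_TH_group[OF y]
    have "sim A C (\<alpha> \<circ>\<^sub>m (x \<circ>\<^sub>m \<beta>)) (\<alpha> \<circ>\<^sub>m (y \<circ>\<^sub>m \<beta>))"
      using \<open>\<Phi> x = \<Phi> y\<close> max_ext_eq_iff[OF hom\<Phi>[OF hx] hom\<Phi>[OF hy]] unfolding \<Phi>_def by simp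
    then have "sim A C (x \<circ>\<^sub>m \<beta>) (y \<circ>\<^sub>m \<beta>)"
      by (rule sim_cancel_left[OF d(5) hom_comp[OF d(3) hx] hom_comp[OF d(3) hy]])
    then have "sim A B x y" by (rule sim_cancel_right[OF d(4,6) hx hy])
    then show "x = y" using max_ext_eq_iff[OF hx hy] x y unfolding TH_group_carrier by simp
  qed
  interpret G: group ?G by (rule group_TH_group[OF B])
  have \<Phi>one: "\<Phi> \<one>\<^bsub>?G\<^esub> = e"
    unfolding TH_group_one \<Phi>_def id_on_comp[OF d(3)]
    using max_ext_eq_iff[OF hom_comp[OF d(3,1)] hH(1)[OF eH]] d(7) hH(2)[OF eH] by simp
  define K where "K = \<Phi> ` carrier ?G"
  have KM: "K \<subseteq> carrier ?M" unfolding K_def using \<Phi>M by blast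
  have iso: "\<Phi> \<in> iso ?G (?M\<lparr>carrier := K, one := x\<rparr>)" for x
    unfolding iso_def hom_def bij_betw_def K_def using \<Phi>mult inj by auto
  \<comment> \<open>Transport along \<Phi> makes K a group with identity e, so K is a competitor for
    H and maximality can be applied to it.\<close>
  have "group ((?M\<lparr>carrier := K, one := e\<rparr>)\<lparr>one := \<Phi> \<one>\<^bsub>?G\<^esub>\<rparr>)"
    by (rule G.iso_imp_img_group[OF iso])
  then have "subgroup_at ?M K e" unfolding subgroup_at_def \<Phi>one using KM by simp
  then have "\<not> H \<subset> K" using max unfolding maximal_subgroup_at_def by blast
  moreover have "H \<subseteq> K"
  proof
    fix h assume h: "h \<in> H"
    obtain h' where h': "h' \<in> H" "h' \<otimes>\<^bsub>?M\<^esub> h = e" "h \<otimes>\<^bsub>?M\<^esub> h' = e"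
      using H.inv_closed[of h] H.l_inv[of h] H.r_inv[of h] h by auto
    have hh: "sim A C e (h' \<circ>\<^sub>m h)" "sim A C e (h \<circ>\<^sub>m h')"
      using simH[OF h'(1) h] simH[OF h h'(1)] h' by simp_all
    have homs: "hom_between A B B (\<beta> \<circ>\<^sub>m (f \<circ>\<^sub>m \<alpha>))" if "f \<in> H" for f
      using hom_comp[OF hom_comp[OF d(1) hH(1)[OF that]] d(3)] .
    have inv: "sim A B ((\<beta> \<circ>\<^sub>m (g \<circ>\<^sub>m \<alpha>)) \<circ>\<^sub>m (\<beta> \<circ>\<^sub>m (f \<circ>\<^sub>m \<alpha>))) (id_on A B)"
      if f: "f \<in> H" and g: "g \<in> H" and gf: "sim A C e (g \<circ>\<^sub>m f)" for f g
    proof -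
      \<comment> \<open>In the product of \<beta>g\<alpha> and \<beta>f\<alpha> the inner
        \<alpha>\<beta> is e and is absorbed by f. What remains is \<beta>e\<alpha> =
        (\<beta>\<alpha>)(\<beta>\<alpha>), the identity.\<close>
      have fa: "hom_between A B C (f \<circ>\<^sub>m \<alpha>)" using hom_comp[OF d(1) hH(1)[OF f]] .
      have "sim A C ((\<alpha> \<circ>\<^sub>m \<beta>) \<circ>\<^sub>m f) f"
        using sim_trans[OF sim_comp_left[OF hH(1)[OF f] d(7)] sim_sym[OF eh(1)[OF f]]] .
      then have "sim A C (g \<circ>\<^sub>m ((\<alpha> \<circ>\<^sub>m \<beta>) \<circ>\<^sub>m f)) e"
        using sim_trans[OF sim_comp_right sim_sym[OF gf]] by blast
      then have "sim A C (g \<circ>\<^sub>m ((\<alpha> \<circ>\<^sub>m \<beta>) \<circ>\<^sub>m f)) (\<alpha> \<circ>\<^sub>m \<beta>)"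
        using sim_trans sim_sym[OF d(7)] by blast
      then have "sim A B (\<beta> \<circ>\<^sub>m ((g \<circ>\<^sub>m ((\<alpha> \<circ>\<^sub>m \<beta>) \<circ>\<^sub>m f)) \<circ>\<^sub>m \<alpha>)) (\<beta> \<circ>\<^sub>m ((\<alpha> \<circ>\<^sub>m \<beta>) \<circ>\<^sub>m \<alpha>))"
        by (intro sim_comp_right sim_comp_left[OF d(1)])
      moreover have "sim A B (\<beta> \<circ>\<^sub>m ((\<alpha> \<circ>\<^sub>m \<beta>) \<circ>\<^sub>m \<alpha>)) (\<beta> \<circ>\<^sub>m \<alpha>)"
        using sim_left_inverse[OF \<beta>\<alpha> hom_comp[OF d(1,3)]] unfolding map_comp_assoc .
      ultimately have "sim A B (\<beta> \<circ>\<^sub>m ((g \<circ>\<^sub>m ((\<alpha> \<circ>\<^sub>m \<beta>) \<circ>\<^sub>m f)) \<circ>\<^sub>m \<alpha>)) (id_on A B)"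
        using sim_trans \<beta>\<alpha> by blast
      then show ?thesis unfolding map_comp_assoc .
    qed
    \<comment> \<open>The preimage of h under \<Phi>: the composite \<alpha>g\<beta> becomes ehe,
      which is h because e is the identity of H.\<close>
    define g where "g = max_ext A B (\<beta> \<circ>\<^sub>m (h \<circ>\<^sub>m \<alpha>))"
    have "inverses A B (\<beta> \<circ>\<^sub>m (h \<circ>\<^sub>m \<alpha>)) (\<beta> \<circ>\<^sub>m (h' \<circ>\<^sub>m \<alpha>))"
      unfolding inverses_def using homs h h' inv[OF h h'(1) hh(1)] inv[OF h'(1) h hh(2)] by simp
    then have g: "g \<in> carrier ?G" unfolding g_def by (rule max_ext_in_TH_group)
    have "sim A C (\<alpha> \<circ>\<^sub>m (g \<circ>\<^sub>m \<beta>)) (\<alpha> \<circ>\<^sub>m ((\<beta> \<circ>\<^sub>m (h \<circ>\<^sub>m \<alpha>)) \<circ>\<^sub>m \<beta>))"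
      unfolding g_def by (intro sim_comp_right sim_comp_left[OF d(3)] sim_sym[OF sim_max_ext[OF homs[OF h]]])
    then have "sim A C (\<alpha> \<circ>\<^sub>m (g \<circ>\<^sub>m \<beta>)) ((\<alpha> \<circ>\<^sub>m \<beta>) \<circ>\<^sub>m (h \<circ>\<^sub>m (\<alpha> \<circ>\<^sub>m \<beta>)))" unfolding map_comp_assoc .
    moreover have "sim A C ((\<alpha> \<circ>\<^sub>m \<beta>) \<circ>\<^sub>m (h \<circ>\<^sub>m (\<alpha> \<circ>\<^sub>m \<beta>))) (e \<circ>\<^sub>m (h \<circ>\<^sub>m e))"
      by (intro sim_comp[OF sim_comp_right[OF d(7)] hom_comp[OF hom_comp[OF d(3,1)] hH(1)[OF h]] d(7)])
    moreover have "sim A C (e \<circ>\<^sub>m (h \<circ>\<^sub>m e)) h"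
      using sim_trans[OF sim_comp_right[OF sim_sym[OF eh(2)[OF h]]] sim_sym[OF eh(1)[OF h]]] .
    ultimately have "sim A C (\<alpha> \<circ>\<^sub>m (g \<circ>\<^sub>m \<beta>)) h" using sim_trans by blast
    then have "\<Phi> g = h" unfolding \<Phi>_def
      using max_ext_eq_iff[OF hom\<Phi>[OF hom_TH_group[OF g]] hH(1)[OF h]] hH(2)[OF h] by simp
    then show "h \<in> K" unfolding K_def using g by blast
  qed
  ultimately have "H = K" by blast
  then have "?G \<cong> ?M\<lparr>carrier := H, one := e\<rparr>" using iso[of e] unfolding is_iso_def by blast
  then show ?thesis by (rule G.iso_sym)
qed

theorem theorem2p1:
  fixes A B :: "'a set" and b :: 'a and k i :: nat
  assumes "k \<ge> 2" and "1 \<le> i" and "i \<le> k - 1"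
    and "finite A" and "card A = k"
    and "finite B" and "card B = i"
  shows "D_index_class A b i \<in> D_classes (TH_monoid A {b}) \<and>
    (\<forall>H e. maximal_subgroup_at (TH_monoid A {b}) H e \<and> H \<subseteq> D_index_class A b i \<longrightarrow>
       (TH_monoid A {b})\<lparr>carrier := H, one := e\<rparr> \<cong> TH_group A B)"
proof (intro conjI allI impI)
  have A: "A \<noteq> {}" and B: "B \<noteq> {}" using assms by auto
  show "D_index_class A b i \<in> D_classes (TH_monoid A {b})"
    using D_index_class_in_D_classes[of A B b] assms B by simp
  fix H e assume H: "maximal_subgroup_at (TH_monoid A {b}) H e \<and> H \<subseteq> D_index_class A b i"
  then have "group ((TH_monoid A {b})\<lparr>carrier := H, one := e\<rparr>)"
    unfolding maximal_subgroup_at_def subgroup_at_def by simp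
  \<comment> \<open>The identity of H is one of its elements and so lies in the indexed class; this
    gives the code size needed to split e through B.\<close>
  then have "e \<in> H" using monoid.one_closed[OF group.is_monoid] by fastforce
  then have e: "e \<in> carrier (TH_monoid A {b})" "e \<noteq> Map.empty"
      "[card (imC A {b} e) = card B] (mod (card A - 1))"
    using H assms(5,7) unfolding D_index_class_def by auto
  obtain \<alpha> \<alpha>' \<beta> \<beta>' where "splitting A B {b} e \<alpha> \<alpha>' \<beta> \<beta>'"
    using splitting_imC[OF assms(4) A assms(6) B e] .
  then show "(TH_monoid A {b})\<lparr>carrier := H, one := e\<rparr> \<cong> TH_group A B"
    using maximal_subgroup_iso[OF assms(6)] H by simp
qed

end
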